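(* Let $X$ be a non-trivial complex Banach space, and let $(A(t))_{t\in\mathbb{R}}$, the evolution system $U(\cdot,\cdot)$ generated by $A(\cdot)$, the constants $M',\omega>0$ and the Green's function $\Gamma(\cdot,\cdot)$ be as in the context. Suppose that $U(\cdot,\cdot)$ is exponentially stable and let $F\in Q\text{-}AAP(\mathbb{R}\times X:X)$. Suppose that for each $\epsilon>0$ there exists a finite number $L(\epsilon)>0$ such that any interval $I'\subseteq\mathbb{R}$ of length $L(\epsilon)$ contains at least one number $\tau\in I'$ for which there exists a finite number $M(\epsilon,\tau)>0$ such that $$\int_{-\infty}^{+\infty}\bigl\|\Gamma(t+\tau,t+\tau-s)-\Gamma(t,t-s)\bigr\|\,ds\le\epsilon\quad\text{provided } t\in\mathbb{R}\text{ and }|t|\ge M(\epsilon,\tau).$$ If there exists a finite number $L\in(0,\omega/(2M'))$ such that $\|F(t,y)-F(t,z)\|\le L\|y-z\|$ for all $y,z\in X$ and $t\in\mathbb{R}$, then there exists a unique mild solution $u(\cdot)$ of $u'(t)=A(t)u(t)+F(t,u(t))$, $t\in\mathbb{R}$, belonging to the class $Q\text{-}AAP(\mathbb{R}:X)$.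
   Context: Standing assumptions. $(A(t))_{t\in\mathbb{R}}$ is a family of closed linear operators on $X$ satisfying: (H1) (Acquistapace–Terreni conditions) there are $\omega_0\ge0$, $\phi\in(\pi/2,\pi)$ and $0<\mu,\nu\le1$ with $\mu+\nu>1$ such that $\overline{\Sigma_\phi}\subseteq\rho(A(t)-\omega_0)$, where $\Sigma_\phi=\{\lambda\in\mathbb{C}\setminus\{0\}:|\arg\lambda|<\phi\}$, and, with bounds uniform in $t,s\in\mathbb{R}$, $\lambda\in\overline{\Sigma_\phi}$: $\|R(\lambda:A(t)-\omega_0)\|=O((1+|\lambda|)^{-1})$ and $\|(A(t)-\omega_0)R(\lambda:A(t)-\omega_0)[R(\omega_0:A(t))-R(\omega_0:A(s))]\|=O(|t-s|^\mu|\lambda|^{-\nu})$. Here $R(\lambda:A)=(\lambda-A)^{-1}$ and $\rho(A)$ is the resolvent set. An evolution system is a family $\{U(t,s):t\ge s\}\subseteq L(X)$ with $U(s,s)=I$, $U(t,s)=U(t,r)U(r,s)$ for $t\ge r\ge s$, and $(t,s)\mapsto U(t,s)x$ continuous on $\{t>s\}$ for each $x\in X$. Under (H1) there is an evolution system $U(\cdot,\cdot)$ generated by $A(\cdot)$ (Acquistapace–Terreni). (H2) $U(\cdot,\cdot)$ is hyperbolic: there exist a uniformly bounded, strongly continuous family of projections $(P(t))_{t\in\mathbb{R}}\subseteq L(X)$ and constants $M',\omega>0$ such that, with $Q(t):=I-P(t)$: (a) $U(t,s)P(s)=P(t)U(t,s)$ for all $t\ge s$; (b) the restriction $U_Q(t,s):Q(s)X\to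 Q(t)X$ of $U(t,s)$ is invertible for all $t\ge s$, and one sets $U_Q(s,t)=U_Q(t,s)^{-1}$; (c) $\|U(t,s)P(s)\|\le M'e^{-\omega(t-s)}$ and $\|U_Q(s,t)Q(t)\|\le M'e^{-\omega(t-s)}$ for all $t\ge s$. $U(\cdot,\cdot)$ is exponentially stable if one can choose $P(t)=I$ for all $t\in\mathbb{R}$ in (H2); this choice is then made, so $Q(t)=0$ and $\|U(t,s)\|\le M'e^{-\omega(t-s)}$ for $t\ge s$. The Green's function is $\Gamma(t,s):=U(t,s)P(s)$ for $t\ge s$ and $\Gamma(t,s):=-U_Q(t,s)Q(s)$ for $t<s$ (so here $\Gamma(t,s)=U(t,s)$ for $t\ge s$ and $\Gamma(t,s)=0$ for $t<s$). A mild solution of $u'(t)=A(t)u(t)+F(t,u(t))$, $t\in\mathbb{R}$, is a bounded continuous $u:\mathbb{R}\to X$ with $u(t)=\int_{-\infty}^{+\infty}\Gamma(t,s)F(s,u(s))\,ds$, $t\in\mathbb{R}$. $Q\text{-}AAP(\mathbb{R}:X)$ (quasi-asymptotically almost periodic functions) is the set of bounded continuous $f:\mathbb{R}\to X$ such that for each $\epsilon>0$ there exists a finite number $L(\epsilon)>0$ such that any interval $I'\subseteq\mathbb{R}$ of length $L(\epsilon)$ contains at least one number $\tau\in I'$ for which there exists a finite number $M(\epsilon,\tau)>0$ with $\|f(t+\tau)-f(t)\|\le\epsilon$ for all $t\in\mathbb{R}$ with $|t|\ge M(\epsilon,\tau)$. $Q\text{-}AAP(\mathbb{R}\times X:X)$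 is the set of continuous $F:\mathbb{R}\times X\to X$ such that for each $\epsilon>0$ there exists a finite number $L(\epsilon)>0$ such that any interval $I'\subseteq\mathbb{R}$ of length $L(\epsilon)$ contains at least one number $\tau\in I'$ for which there exists a finite number $M(\epsilon,\tau)>0$ such that for each bounded subset $B$ of $X$: $\|F(t+\tau,x)-F(t,x)\|\le\epsilon$ for all $t\in\mathbb{R}$, $x\in B$ with $|t|\ge M(\epsilon,\tau)$.
   Formalization: The formal theorem additionally assumes that t ↦ F(t,0) is bounded on ℝ; without this the claim fails, e.g. for X = ℂ, A(t) = -1, F(t,x) = ln(1+|t|), where no bounded mild solution exists. *)

theory Defs
  imports "HOL-Analysis.Analysis"
begin

text \<open>Complex Banach spaces, as Banach spaces with a compatible complex scalar multiplication.\<close>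

class complex_banach = banach +
  fixes scaleC :: "complex \<Rightarrow> 'a \<Rightarrow> 'a"  (infixr \<open>*\<^sub>C\<close> 75)
  assumes scaleC_add_right: "c *\<^sub>C (x + y) = c *\<^sub>C x + c *\<^sub>C y"
    and scaleC_add_left: "(c + d) *\<^sub>C x = c *\<^sub>C x + d *\<^sub>C x"
    and scaleC_scaleC: "c *\<^sub>C (d *\<^sub>C x) = (c * d) *\<^sub>C x"
    and scaleC_of_real: "complex_of_real r *\<^sub>C x = r *\<^sub>R x"
    and norm_scaleC: "norm (c *\<^sub>C x) = cmod c * norm x"

text \<open>
  The algebra \<open>L(X)\<close> consists of the complex-linear elements of \<open>'a \<Rightarrow>\<^sub>L 'a\<close> (bounded real-linear
  maps); \<open>norm\<close> on that type is the operator norm.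
\<close>

definition clinear_blinfun :: "('a::complex_banach \<Rightarrow>\<^sub>L 'a) \<Rightarrow> bool" where
  "clinear_blinfun T \<longleftrightarrow> (\<forall>c x. T (c *\<^sub>C x) = c *\<^sub>C T x)"


subsection \<open>Unbounded operators and resolvents\<close>

text \<open>
  An operator in \<open>X\<close> is given by its domain \<open>D\<close> and a map \<open>A\<close> whose values outside \<open>D\<close> are
  irrelevant. The domain is not assumed to be dense.
\<close>

definition closed_linear_operator :: "'a::complex_banach set \<Rightarrow> ('a \<Rightarrow> 'a) \<Rightarrow> bool" where
  "closed_linear_operator D A \<longleftrightarrow>
     0 \<in> D \<and>
     (\<forall>x\<in>D. \<forall>y\<in>D. x + y \<in> D \<and> A (x + y) = A x + A y) \<and>
     (\<forall>c. \<forall>x\<in>D. c *\<^sub>C x \<in> D \<and> A (c *\<^sub>C x) = c *\<^sub>C A x) \<and>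
     closed {(x, A x) |x. x \<in> D}"

definition resolvent_set :: "'a::complex_banach set \<Rightarrow> ('a \<Rightarrow> 'a) \<Rightarrow> complex set" where
  "resolvent_set D A =
     {z. bij_betw (\<lambda>x. z *\<^sub>C x - A x) D UNIV \<and>
         bounded_linear (the_inv_into D (\<lambda>x. z *\<^sub>C x - A x))}"

definition resolvent :: "complex \<Rightarrow> 'a::complex_banach set \<Rightarrow> ('a \<Rightarrow> 'a) \<Rightarrow> ('a \<Rightarrow>\<^sub>L 'a)" where
  "resolvent z D A = Blinfun (the_inv_into D (\<lambda>x. z *\<^sub>C x - A x))"

definition sector :: "real \<Rightarrow> complex set" where
  "sector \<phi> = {z. z \<noteq> 0 \<and> \<bar>Arg z\<bar> < \<phi>}"

text \<open>
  In the second estimate the point \<open>z = 0\<close> is excluded, since there the bound is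
  \<open>\<bar>z\<bar>\<^sup>-\<^sup>\<nu> = \<infinity>\<close>, whereas \<open>0 powr (- \<nu>) = 0\<close> in HOL.
\<close>

definition acquistapace_terreni ::
  "(real \<Rightarrow> 'a::complex_banach set) \<Rightarrow> (real \<Rightarrow> 'a \<Rightarrow> 'a) \<Rightarrow> real \<Rightarrow> real \<Rightarrow> real \<Rightarrow> real \<Rightarrow> bool" where
  "acquistapace_terreni D A \<omega>\<^sub>0 \<phi> \<mu> \<nu> \<longleftrightarrow>
     0 \<le> \<omega>\<^sub>0 \<and> pi / 2 < \<phi> \<and> \<phi> < pi \<and>
     0 < \<mu> \<and> \<mu> \<le> 1 \<and> 0 < \<nu> \<and> \<nu> \<le> 1 \<and> 1 < \<mu> + \<nu> \<and>
     (let A\<^sub>0 = (\<lambda>t x. A t x - complex_of_real \<omega>\<^sub>0 *\<^sub>C x) in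
       (\<forall>t. closure (sector \<phi>) \<subseteq> resolvent_set (D t) (A\<^sub>0 t)) \<and>
       (\<exists>K. \<forall>t. \<forall>z\<in>closure (sector \<phi>). norm (resolvent z (D t) (A\<^sub>0 t)) \<le> K / (1 + cmod z)) \<and>
       (\<exists>K. \<forall>t s. \<forall>z\<in>closure (sector \<phi>) - {0}. \<forall>x.
          norm (A\<^sub>0 t (resolvent z (D t) (A\<^sub>0 t)
                  (resolvent (complex_of_real \<omega>\<^sub>0) (D t) (A t) x
                   - resolvent (complex_of_real \<omega>\<^sub>0) (D s) (A s) x)))
          \<le> K * \<bar>t - s\<bar> powr \<mu> * cmod z powr (- \<nu>) * norm x))"


subsection \<open>Evolution systems\<close>

text \<open>Only the values \<open>U t s\<close> with \<open>t \<ge> s\<close> are relevant.\<close>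

definition evolution_system :: "(real \<Rightarrow> real \<Rightarrow> ('a::complex_banach \<Rightarrow>\<^sub>L 'a)) \<Rightarrow> bool" where
  "evolution_system U \<longleftrightarrow>
     (\<forall>t s. s \<le> t \<longrightarrow> clinear_blinfun (U t s)) \<and>
     (\<forall>s. U s s = id_blinfun) \<and>
     (\<forall>t r s. s \<le> r \<and> r \<le> t \<longrightarrow> U t s = U t r o\<^sub>L U r s) \<and>
     (\<forall>x. continuous_on {(t, s). s < t} (\<lambda>(t, s). U t s x))"

text \<open>
  \<open>U\<close> is generated by \<open>A(\<cdot>)\<close> in the sense of Acquistapace and Terreni: \<open>U(\<cdot>,s)\<close> is a \<open>C\<^sup>1\<close> function
  on \<open>(s,\<infinity>)\<close> with values in \<open>L(X)\<close>, \<open>\<partial>\<^sub>t U(t,s) = A(t) U(t,s)\<close> (the derivative is \<open>V t s\<close> below),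
  with the parabolic estimates \<open>\<parallel>A(t)\<^sup>k U(t,s)\<parallel> \<le> C (t - s)\<^sup>-\<^sup>k\<close> for \<open>0 < t - s \<le> 1\<close>, \<open>k = 0, 1\<close>,
  and the initial value is attained. As \<open>D(A(s))\<close> need not be dense, \<open>U(t,s)x \<rightarrow> x\<close> is only
  available on the closure of \<open>D(A(s))\<close>; on the remaining vectors it holds after applying a
  resolvent of \<open>A(s)\<close>, without which \<open>U(t,s)\<close> would not be determined outside that closure.
\<close>

definition generates ::
  "(real \<Rightarrow> 'a::complex_banach set) \<Rightarrow> (real \<Rightarrow> 'a \<Rightarrow> 'a) \<Rightarrow> (real \<Rightarrow> real \<Rightarrow> ('a \<Rightarrow>\<^sub>L 'a)) \<Rightarrow> bool" where
  "generates D A U \<longleftrightarrow>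
     (\<exists>V :: real \<Rightarrow> real \<Rightarrow> ('a \<Rightarrow>\<^sub>L 'a).
        (\<forall>t s x. s < t \<longrightarrow> U t s x \<in> D t \<and> blinfun_apply (V t s) x = A t (U t s x)) \<and>
        (\<forall>t s. s < t \<longrightarrow> ((\<lambda>r. U r s) has_vector_derivative V t s) (at t)) \<and>
        (\<forall>s. continuous_on {s<..} (\<lambda>t. V t s)) \<and>
        (\<exists>C. \<forall>t s. s < t \<and> t \<le> s + 1 \<longrightarrow> norm (U t s) \<le> C \<and> norm (V t s) \<le> C / (t - s))) \<and>
     (\<forall>s. \<forall>x\<in>closure (D s). ((\<lambda>t. U t s x) \<longlongrightarrow> x) (at_right s)) \<and>
     (\<forall>s x. \<forall>z\<in>resolvent_set (D s) (A s).
        ((\<lambda>t. resolvent z (D s) (A s) (U t s x)) \<longlongrightarrow> resolvent z (D s) (A s) x) (at_right s))"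


subsection \<open>Hyperbolicity, Green's function, mild solutions\<close>

definition compl_proj :: "(real \<Rightarrow> ('a::complex_banach \<Rightarrow>\<^sub>L 'a)) \<Rightarrow> real \<Rightarrow> ('a \<Rightarrow>\<^sub>L 'a)" where
  "compl_proj P t = id_blinfun - P t"

text \<open>
  For \<open>t \<ge> s\<close>, \<open>inv_Q U P s t\<close> is the operator \<open>U\<^sub>Q(s,t) = U\<^sub>Q(t,s)\<^sup>-\<^sup>1\<close> from \<open>Q(t)X\<close> to \<open>Q(s)X\<close>.
\<close>

definition inv_Q ::
  "(real \<Rightarrow> real \<Rightarrow> ('a::complex_banach \<Rightarrow>\<^sub>L 'a)) \<Rightarrow> (real \<Rightarrow> ('a \<Rightarrow>\<^sub>L 'a)) \<Rightarrow> real \<Rightarrow> real \<Rightarrow> 'a \<Rightarrow> 'a" where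
  "inv_Q U P s t = the_inv_into (range (compl_proj P s)) (U t s)"

definition hyperbolic ::
  "(real \<Rightarrow> real \<Rightarrow> ('a::complex_banach \<Rightarrow>\<^sub>L 'a)) \<Rightarrow> (real \<Rightarrow> ('a \<Rightarrow>\<^sub>L 'a)) \<Rightarrow> real \<Rightarrow> real \<Rightarrow> bool" where
  "hyperbolic U P M' \<omega> \<longleftrightarrow>
     0 < M' \<and> 0 < \<omega> \<and>
     (\<forall>t. clinear_blinfun (P t) \<and> P t o\<^sub>L P t = P t) \<and>
     (\<exists>K. \<forall>t. norm (P t) \<le> K) \<and>
     (\<forall>x. continuous_on UNIV (\<lambda>t. P t x)) \<and>
     (\<forall>t s. s \<le> t \<longrightarrow>
        U t s o\<^sub>L P s = P t o\<^sub>L U t s \<and>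
        bij_betw (U t s) (range (compl_proj P s)) (range (compl_proj P t)) \<and>
        norm (U t s o\<^sub>L P s) \<le> M' * exp (- \<omega> * (t - s)) \<and>
        (\<forall>x. norm (inv_Q U P s t (compl_proj P t x)) \<le> M' * exp (- \<omega> * (t - s)) * norm x))"

definition exponentially_stable ::
  "(real \<Rightarrow> real \<Rightarrow> ('a::complex_banach \<Rightarrow>\<^sub>L 'a)) \<Rightarrow> real \<Rightarrow> real \<Rightarrow> bool" where
  "exponentially_stable U M' \<omega> \<longleftrightarrow> hyperbolic U (\<lambda>t. id_blinfun) M' \<omega>"

definition green ::
  "(real \<Rightarrow> real \<Rightarrow> ('a::complex_banach \<Rightarrow>\<^sub>L 'a)) \<Rightarrow> (real \<Rightarrow> ('a \<Rightarrow>\<^sub>L 'a)) \<Rightarrow> real \<Rightarrow> real \<Rightarrow> ('a \<Rightarrow>\<^sub>L 'a)" where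
  "green U P t s =
     (if s \<le> t then U t s o\<^sub>L P s else - Blinfun (\<lambda>x. inv_Q U P t s (compl_proj P s x)))"

text \<open>
  The integral is the Henstock--Kurzweil integral over \<open>\<real>\<close>, because the Bochner integral of the
  library needs a separable (second countable) target. For an exponentially stable \<open>U\<close> and
  bounded continuous \<open>s \<mapsto> F(s,u(s))\<close> the integrand is continuous on \<open>(-\<infinity>,t)\<close>, zero on \<open>(t,\<infinity>)\<close>
  and dominated in norm by an exponential, so both integrals exist and agree.
\<close>

definition mild_solution ::
  "(real \<Rightarrow> real \<Rightarrow> ('a::complex_banach \<Rightarrow>\<^sub>L 'a)) \<Rightarrow> (real \<Rightarrow> 'a \<Rightarrow> 'a) \<Rightarrow> (real \<Rightarrow> 'a) \<Rightarrow> bool" where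
  "mild_solution \<Gamma> F u \<longleftrightarrow>
     bounded (range u) \<and> continuous_on UNIV u \<and>
     (\<forall>t. ((\<lambda>s. \<Gamma> t s (F s (u s))) has_integral u t) UNIV)"


subsection \<open>Quasi-asymptotically almost periodic functions\<close>

definition QAAP :: "(real \<Rightarrow> 'a::complex_banach) set" where
  "QAAP = {f. bounded (range f) \<and> continuous_on UNIV f \<and>
     (\<forall>\<epsilon>>0. \<exists>l>0. \<forall>a. \<exists>\<tau>\<in>{a..a + l}. \<exists>M>0.
        \<forall>t. M \<le> \<bar>t\<bar> \<longrightarrow> norm (f (t + \<tau>) - f t) \<le> \<epsilon>)}"

text \<open>
  Unlike those of \<open>QAAP\<close>, the members of the two-variable class need not be bounded on
  \<open>\<real> \<times> B\<close> for bounded \<open>B\<close>: \<open>F(t,x) = ln(1 + \<bar>t\<bar>) x\<^sub>0\<close> is a member. For \<open>A(t) = -1\<close>, where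
  \<open>U(t,s) = exp(-(t - s))\<close>, the equation \<open>u' = A(t) u + F(t,u)\<close> then has no bounded mild solution
  when \<open>x\<^sub>0 \<noteq> 0\<close>. Boundedness of \<open>t \<mapsto> F(t,0)\<close> therefore has to be assumed separately.
\<close>

definition QAAP_param :: "(real \<Rightarrow> 'a::complex_banach \<Rightarrow> 'a) set" where
  "QAAP_param = {F. continuous_on UNIV (\<lambda>(t, x). F t x) \<and>
     (\<forall>\<epsilon>>0. \<exists>l>0. \<forall>a. \<exists>\<tau>\<in>{a..a + l}. \<exists>M>0.
        \<forall>B. bounded B \<longrightarrow> (\<forall>t. \<forall>x\<in>B. M \<le> \<bar>t\<bar> \<longrightarrow> norm (F (t + \<tau>) x - F t x) \<le> \<epsilon>))}"

end

theory Submission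
  imports Defs
begin

text \<open>
  The map \<open>u \<mapsto> \<integral> \<Gamma>(t,s) F(s,u(s)) ds\<close> is a contraction of the bounded continuous functions, since
  \<open>M' L / \<omega> < 1 / 2\<close>, so only the almost periodicity of its fixed point \<open>u\<close> is at stake. If \<open>\<tau>\<close> is
  an \<open>\<epsilon>\<close>-period near infinity both of \<open>F\<close> and of \<open>\<Gamma>\<close>, the integral equation bounds the limit
  superior of \<open>\<parallel>u(t + \<tau>) - u(t)\<parallel>\<close> by a multiple of \<open>\<epsilon>\<close>.

  The two hypotheses give relatively dense sets of periods of \<open>F\<close> and of \<open>\<Gamma>\<close> separately, and such
  sets may be disjoint. A pigeonhole argument yields common periods as soon as small translations are
  periods of \<open>\<Gamma>\<close>, that is, once \<open>\<parallel>U(t + h, s + h) - U(t, s)\<parallel>\<close> tends to \<open>0\<close> with \<open>h\<close>, uniformly for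
  \<open>t - s \<ge> d > 0\<close>. Continuity in \<open>t\<close> is clear from \<open>\<parallel>A(t) U(t,s)\<parallel> \<le> C / (t - s)\<close>. For continuity in
  \<open>s\<close>, one has to show that \<open>U(r + \<eta>, r)\<close> almost annihilates the vectors \<open>y = x - U(r, r - h) x\<close>.
  Resolvents of \<open>A(r)\<close> do, as \<open>h\<close> tends to \<open>0\<close>, and the Acquistapace--Terreni condition says that
  the Laplace transform of \<open>\<sigma> \<mapsto> U(r + \<sigma>, r)\<close> at a large real \<open>\<lambda>\<close> is close to the resolvent of
  \<open>A(r)\<close> at \<open>\<lambda>\<close>. By the Weierstrass theorem, finitely many Laplace transforms recover
  the value of a bounded Lipschitz function at a point.
\<close>

subsection \<open>Integrals over the real line\<close>

text \<open>The integral over the line is a limit over large boxes, so the reflection is done box by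
  box with the affine rule. Enlarging the radius by \<open>\<bar>c\<bar>\<close> keeps
  \<open>ball 0 B\<close> inside the reflected box.\<close>

lemma has_integral_UNIV_reflect:
  fixes f :: "real \<Rightarrow> 'a::real_normed_vector"
  assumes "(f has_integral i) UNIV"
  shows "((\<lambda>x. f (c - x)) has_integral i) UNIV"
proof -
  have *: "\<not> (\<exists>a b. (UNIV::real set) = cbox a b)"
    by (metis bounded_cbox not_bounded_UNIV)
  have "\<exists>B>0. \<forall>a b. ball 0 B \<subseteq> cbox a b \<longrightarrow>
      (\<exists>z. ((\<lambda>x. f (c - x)) has_integral z) (cbox a b) \<and> norm (z - i) < e)" if "e > 0" for e
  proof -
    obtain B where B: "B > 0" "\<And>a b. ball 0 B \<subseteq> cbox a b \<Longrightarrow>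
      (\<exists>z. (f has_integral z) (cbox a b) \<and> norm (z - i) < e)"
      using has_integral_altD[OF assms * \<open>e > 0\<close>] by auto
    show ?thesis
    proof (intro exI[of _ "B + \<bar>c\<bar>"] conjI allI impI)
      fix a b :: real
      assume sub: "ball 0 (B + \<bar>c\<bar>) \<subseteq> cbox a b"
      have "x \<in> cbox (c - b) (c - a)" if "x \<in> ball 0 B" for x
      proof -
        have "c - x \<in> ball 0 (B + \<bar>c\<bar>)" using that by (auto simp: dist_norm)
        then have "c - x \<in> cbox a b" using sub by blast
        then show ?thesis by auto
      qed
      then obtain z where z: "(f has_integral z) (cbox (c - b) (c - a))" "norm (z - i) < e"
        using B(2) by blast
      have "((\<lambda>x. f (- 1 *\<^sub>R x + c)) has_integral (1 / \<bar>- 1\<bar> ^ DIM(real)) *\<^sub>R z)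
              ((\<lambda>x. (1 / - 1) *\<^sub>R x + - ((1 / - 1) *\<^sub>R c)) ` cbox (c - b) (c - a))"
        by (rule has_integral_affinity[OF z(1)]) simp
      moreover have "(\<lambda>x. (1 / - 1) *\<^sub>R x + - ((1 / - 1) *\<^sub>R c)) ` cbox (c - b) (c - a) = cbox a b"
      proof -
        have "(\<lambda>x. c - x) ` {c - b..c - a} = {a..b}"
          by (simp add: image_diff_atLeastAtMost)
        then show ?thesis by simp
      qed
      ultimately have "((\<lambda>x. f (c - x)) has_integral z) (cbox a b)"
        by simp
      then show "\<exists>z. ((\<lambda>x. f (c - x)) has_integral z) (cbox a b) \<and> norm (z - i) < e"
        using z(2) by blast
    qed (use B in auto)
  qed
  then show ?thesis
    by (subst has_integral_alt) (use * in auto)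
qed

text \<open>Cauchy criterion over large boxes: the two tails of \<open>f\<close> outside
  \<open>{-B..B}\<close> are bounded by those of \<open>g\<close>, which are small. Only
  integrability on compact intervals is asked of the vector-valued \<open>f\<close>.\<close>

lemma integrable_on_UNIV_dominated:
  fixes f :: "real \<Rightarrow> 'a::banach" and g :: "real \<Rightarrow> real"
  assumes f: "\<And>a b. f integrable_on {a..b}"
    and g: "g integrable_on UNIV"
    and le: "\<And>x. norm (f x) \<le> g x"
  shows "f integrable_on UNIV"
proof -
  have gi: "g integrable_on {a..b}" for a b
    using integrable_on_subinterval[OF g, of a b] by simp
  have "\<exists>B>0. \<forall>a b c d. ball 0 B \<subseteq> cbox a b \<and> ball 0 B \<subseteq> cbox c d \<longrightarrow>
      norm (integral (cbox a b) f - integral (cbox c d) f) < e" if "e > 0" for e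
  proof -
    obtain B where B: "B > 0" "\<And>a b c d. ball 0 B \<subseteq> cbox a b \<Longrightarrow> ball 0 B \<subseteq> cbox c d \<Longrightarrow>
        norm (integral (cbox a b) g - integral (cbox c d) g) < e / 2"
    proof -
      have "\<forall>e>0. \<exists>B>0. \<forall>a b c d. ball 0 B \<subseteq> cbox a b \<and> ball 0 B \<subseteq> cbox c d \<longrightarrow>
          norm (integral (cbox a b) g - integral (cbox c d) g) < e"
        using iffD1[OF integrable_alt g] by simp
      from this[rule_format, OF half_gt_zero[OF \<open>e > 0\<close>]] show ?thesis
        using that by blast
    qed
    have main: "norm (integral {a..b} f - integral {-B..B} f) < e / 2" if "ball 0 B \<subseteq> cbox a b" for a b
    proof -
      have "closure (ball 0 B) \<subseteq> cbox a b"
        using that by (intro closure_minimal) auto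
      then have "{-B..B} \<subseteq> {a..b}"
        using \<open>B > 0\<close> by (simp add: cball_eq_atLeastAtMost)
      then have ab: "a \<le> -B" "B \<le> b" "-B \<le> B" using \<open>B > 0\<close> by auto
      have split: "integral {a..b} h = integral {a..-B} h + integral {-B..B} h + integral {B..b} h"
        if "\<And>a b. h integrable_on {a..b}" for h :: "real \<Rightarrow> 'c::banach"
      proof -
        have "integral {a..-B} h + integral {-B..b} h = integral {a..b} h"
          by (rule Henstock_Kurzweil_Integration.integral_combine) (use ab that in auto)
        moreover have "integral {-B..B} h + integral {B..b} h = integral {-B..b} h"
          by (rule Henstock_Kurzweil_Integration.integral_combine) (use ab that in auto)
        ultimately show ?thesis by (metis add.assoc)
      qed
      have "norm (integral {a..b} f - integral {-B..B} f)
          = norm (integral {a..-B} f + integral {B..b} f)"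
        by (simp add: split[OF f])
      also have "\<dots> \<le> integral {a..-B} g + integral {B..b} g"
        by (intro norm_triangle_mono integral_norm_bound_integral f gi le)
      also have "\<dots> = integral {a..b} g - integral {-B..B} g"
        by (simp add: split[OF gi])
      also have "\<dots> < e / 2"
      proof -
        have "ball 0 B \<subseteq> cbox (-B) B" by (auto simp: dist_norm)
        from B(2)[OF that this] have "\<bar>integral {a..b} g - integral {-B..B} g\<bar> < e / 2" by simp
        then show ?thesis by linarith
      qed
      finally show ?thesis .
    qed
    show ?thesis
    proof (intro exI[of _ B] conjI allI impI)
      fix a b c d :: real
      assume "ball 0 B \<subseteq> cbox a b \<and> ball 0 B \<subseteq> cbox c d"
      then have "norm (integral {a..b} f - integral {-B..B} f) < e / 2"
        "norm (integral {c..d} f - integral {-B..B} f) < e / 2" using main by auto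
      then show "norm (integral (cbox a b) f - integral (cbox c d) f) < e"
        using norm_diff_triangle_less[of "integral {a..b} f" "integral {-B..B} f" "e/2" "integral {c..d} f" "e/2"]
        by (simp add: norm_minus_commute)
    qed (use B in auto)
  qed
  then show ?thesis
    by (subst integrable_alt) (use f in auto)
qed

text \<open>
  The primitive is Lipschitz continuous, hence extends to the endpoint, and the fundamental
  theorem of calculus ignores the endpoints.
\<close>

lemma integrable_on_Icc_bounded_continuous_Ioc:
  fixes f :: "real \<Rightarrow> 'a::banach"
  assumes cont: "continuous_on {a<..b} f"
    and bound: "\<And>x. a < x \<Longrightarrow> x \<le> b \<Longrightarrow> norm (f x) \<le> C"
  shows "f integrable_on {a..b}"
proof (cases "a < b")
  case True
  have C: "0 \<le> C" using bound[of b] True norm_ge_zero[of "f b"] by linarith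
  have int: "f integrable_on {x..y}" if "a < x" "y \<le> b" for x y
    by (rule integrable_continuous_real, rule continuous_on_subset[OF cont]) (use that in auto)
  define H where "H x = - integral {x..b} f" for x
  have H_diff: "H y - H x = integral {x..y} f" if "a < x" "x \<le> y" "y \<le> b" for x y
    using Henstock_Kurzweil_Integration.integral_combine[where a=x and c=y and b=b and f=f] that int[of x b] by (simp add: H_def algebra_simps)
  have lip: "norm (H y - H x) \<le> C * (y - x)" if "a < x" "x \<le> y" "y \<le> b" for x y
  proof -
    have "norm (integral {x..y} f) \<le> C * (y - x)"
      using that by (intro integral_bound continuous_on_subset[OF cont] bound) auto
    then show ?thesis by (simp add: H_diff[OF that])
  qed
  have "C-lipschitz_on {a<..b} H"
  proof (rule lipschitz_onI)
    fix x y assume "x \<in> {a<..b}" "y \<in> {a<..b}"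
    then show "dist (H x) (H y) \<le> C * dist x y"
      using lip[of x y] lip[of y x] by (cases "x \<le> y") (auto simp: dist_norm norm_minus_commute)
  qed (rule C)
  then have "uniformly_continuous_on {a<..b} H"
    by (rule lipschitz_on_uniformly_continuous)
  then obtain G where G: "uniformly_continuous_on (closure {a<..b}) G"
      "\<And>x. x \<in> {a<..b} \<Longrightarrow> H x = G x"
    by (rule uniformly_continuous_on_extension_on_closure) blast
  have "continuous_on {a..b} G"
    using uniformly_continuous_imp_continuous[OF G(1)] True by simp
  moreover have "(G has_vector_derivative f x) (at x)" if x: "x \<in> {a<..<b}" for x
  proof -
    \<comment> \<open>Integrating from \<open>c\<close> instead of \<open>a\<close> avoids the
      endpoint where \<open>f\<close> may be singular; \<open>G\<close> differs from this primitive
      by the constant \<open>H c\<close>.\<close>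
    define c where "c = (a + x) / 2"
    have c: "a < c" "c < x" using x by (auto simp: c_def)
    have "((\<lambda>u. integral {c..u} f) has_vector_derivative f x) (at x within {c..b})"
      using c x by (intro integral_has_vector_derivative continuous_on_subset[OF cont]) auto
    then have "((\<lambda>u. integral {c..u} f) has_vector_derivative f x) (at x)"
      using c x by (subst (asm) at_within_interior) auto
    then have deriv: "((\<lambda>u. H c + integral {c..u} f) has_vector_derivative f x) (at x)"
      by (auto intro!: derivative_eq_intros)
    have "H c + integral {c..u} f = G u" if "u \<in> {c<..<b}" for u
    proof -
      have "integral {c..u} f = H u - H c" by (rule H_diff[symmetric]) (use that c in auto)
      moreover have "H u = G u" by (rule G(2)) (use that c in auto)
      ultimately show ?thesis by (metis add.commute diff_add_cancel)
    qed
    from has_vector_derivative_transform_within_open[OF deriv open_greaterThanLessThan _ this]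
    show ?thesis using c x by simp
  qed
  ultimately have "(f has_integral (G b - G a)) {a..b}"
    using True by (intro fundamental_theorem_of_calculus_interior) auto
  then show ?thesis by blast
next
  case False
  then show ?thesis using integrable_on_refl[of f b] by (cases "a = b") auto
qed

section \<open>One-sided kernels dominating the Green's function\<close>

definition exp_kernel :: "real \<Rightarrow> real \<Rightarrow> real" where
  "exp_kernel a s = (if 0 \<le> s then exp (- a * s) else 0)"

lemma exp_kernel_nonneg [simp]: "0 \<le> exp_kernel a s"
  by (simp add: exp_kernel_def)

lemma has_integral_exp_kernel:
  assumes "0 < a"
  shows "(exp_kernel a has_integral 1 / a) UNIV"
proof -
  have "((\<lambda>s. if s \<in> {0..} then exp (- a * s) else 0) has_integral 1 / a) UNIV"
    using has_integral_exp_minus_to_infinity[OF assms, of 0] by (subst has_integral_restrict_UNIV) simp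
  then show ?thesis by (simp add: exp_kernel_def[abs_def])
qed

lemma borel_measurable_exp_kernel [measurable]: "exp_kernel a \<in> borel_measurable borel"
  unfolding exp_kernel_def[abs_def] by measurable

lemma has_integral_indicator_Icc:
  fixes a b :: real
  assumes "a \<le> b"
  shows "(indicat_real {a..b} has_integral (b - a)) UNIV"
proof -
  have "((\<lambda>x. 1) has_integral (b - a)) {a..b}"
    using has_integral_const_real[of "1::real" a b] assms by simp
  then have "((\<lambda>x. if x \<in> {a..b} then 1 else 0) has_integral (b - a)) UNIV"
    by (simp only: has_integral_restrict_UNIV)
  moreover have "(\<lambda>x. if x \<in> {a..b} then 1 else 0) = indicat_real {a..b}"
    by (simp add: fun_eq_iff indicator_def)
  ultimately show ?thesis by (simp only:)
qed

subsection \<open>Common almost periods\<close>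

text \<open>
  Two representatives whose difference \<open>p - q\<close> falls into the same small bin produce, by taking
  differences, a period of the first family that is within \<open>\<delta>\<close> of one of the second.
\<close>

lemma common_relatively_dense:
  fixes P Q :: "real \<Rightarrow> real set"
  assumes P: "\<And>e. e > 0 \<Longrightarrow> \<exists>l>0. \<forall>a. \<exists>\<tau>\<in>{a..a + l}. \<tau> \<in> P e"
    and Q: "\<And>e. e > 0 \<Longrightarrow> \<exists>l>0. \<forall>a. \<exists>\<tau>\<in>{a..a + l}. \<tau> \<in> Q e"
    and P_diff: "\<And>d e x y. x \<in> P d \<Longrightarrow> y \<in> P e \<Longrightarrow> x - y \<in> P (d + e)"
    and Q_diff: "\<And>d e x y. x \<in> Q d \<Longrightarrow> y \<in> Q e \<Longrightarrow> x - y \<in> Q (d + e)"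
    and Q_small: "\<And>e. e > 0 \<Longrightarrow> \<exists>\<delta>>0. \<forall>h. \<bar>h\<bar> < \<delta> \<longrightarrow> h \<in> Q e"
    and e: "e > 0"
  shows "\<exists>l>0. \<forall>a. \<exists>\<tau>\<in>{a..a + l}. \<tau> \<in> P e \<and> \<tau> \<in> Q e"
proof -
  obtain l1 where l1: "l1 > 0" "\<forall>a. \<exists>\<tau>\<in>{a..a + l1}. \<tau> \<in> P (e / 2)"
    using P[of "e / 2"] e by auto
  obtain l2 where l2: "l2 > 0" "\<forall>a. \<exists>\<tau>\<in>{a..a + l2}. \<tau> \<in> Q (e / 4)"
    using Q[of "e / 4"] e by auto
  obtain \<delta> where \<delta>: "\<delta> > 0" "\<And>h. \<bar>h\<bar> < \<delta> \<Longrightarrow> h \<in> Q (e / 2)"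
    using Q_small[of "e / 2"] e by auto
  obtain p where p: "\<And>a. p a \<in> {a..a + l1}" "\<And>a. p a \<in> P (e / 2)"
    using l1(2) by metis
  obtain q where q: "\<And>a. q a \<in> {a..a + l2}" "\<And>a. q a \<in> Q (e / 4)"
    using l2(2) by metis
  \<comment> \<open>\<open>p a\<close> and \<open>q a\<close> lie in windows that start at the same
    point, so \<open>p a - q a\<close> stays in a bounded interval and only finitely many bins of
    width \<delta> occur.\<close>
  define bin where "bin a = \<lfloor>(p a - q a) / \<delta>\<rfloor>" for a
  have "bin a \<in> {\<lfloor>- l2 / \<delta>\<rfloor>..\<lfloor>l1 / \<delta>\<rfloor>}" for a
  proof -
    have "- l2 / \<delta> \<le> (p a - q a) / \<delta>" "(p a - q a) / \<delta> \<le> l1 / \<delta>"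
      using p(1)[of a] q(1)[of a] \<delta>(1) by (intro divide_right_mono; simp)+
    then show ?thesis unfolding bin_def by (auto intro: floor_mono)
  qed
  then have "finite (range bin)"
    by (meson finite_atLeastAtMost_int finite_subset image_subsetI)
  moreover define rep where "rep = inv bin"
  have rep: "bin (rep k) = k" if "k \<in> range bin" for k
    using f_inv_into_f[OF that] by (simp add: rep_def)
  ultimately have fin: "finite ((\<lambda>k. \<bar>rep k\<bar>) ` range bin)" by simp
  define K where "K = Max ((\<lambda>k. \<bar>rep k\<bar>) ` range bin)"
  have K: "\<bar>rep (bin a)\<bar> \<le> K" for a
    unfolding K_def by (rule Max_ge[OF fin]) simp
  have K0: "K \<ge> 0" using K[of 0] by linarith
  show ?thesis
  proof (intro exI[of _ "2 * K + 2 * l1"] conjI allI)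
    fix a
    \<comment> \<open>The shift by \<open>K + l1\<close> ensures \<open>p b - p c \<ge> a\<close>,
      because \<open>p c \<le> K + l1\<close>.\<close>
    define b where "b = a + K + l1"
    define c where "c = rep (bin b)"
    have c: "bin c = bin b" "\<bar>c\<bar> \<le> K" using rep[of "bin b"] K[of b] by (auto simp: c_def)
    define \<tau> where "\<tau> = p b - p c"
    have "\<tau> \<in> P (e / 2 + e / 2)" unfolding \<tau>_def by (intro P_diff p)
    moreover have "\<tau> \<in> Q e"
    proof -
      \<comment> \<open>\<open>h\<close> is the mismatch between the two differences. It is below
        \<delta> since \<open>b\<close> and \<open>c\<close> share a bin, hence is itself a period
        of the second family; the budget is \<open>e / 4 + e / 4 + e / 2\<close>.\<close>
      define h where "h = (q b - q c) - \<tau>"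
      have "\<lfloor>(p b - q b) / \<delta>\<rfloor> = \<lfloor>(p c - q c) / \<delta>\<rfloor>" using c(1) by (simp add: bin_def)
      then have "\<bar>(p b - q b) / \<delta> - (p c - q c) / \<delta>\<bar> < 1" by linarith
      then have "\<bar>(p b - q b) - (p c - q c)\<bar> < \<delta>"
        using \<delta>(1) by (simp add: diff_divide_distrib[symmetric])
      then have "\<bar>h\<bar> < \<delta>" by (simp add: h_def \<tau>_def)
      then have "(q b - q c) - h \<in> Q ((e / 4 + e / 4) + e / 2)"
        by (intro Q_diff q \<delta>(2))
      moreover have "(e / 4 + e / 4) + e / 2 = e" by simp
      ultimately show ?thesis by (simp add: h_def)
    qed
    moreover have "\<tau> \<in> {a..a + (2 * K + 2 * l1)}"
      using p(1)[of b] p(1)[of c] c(2) by (auto simp: \<tau>_def b_def)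
    ultimately show "\<exists>\<tau>\<in>{a..a + (2 * K + 2 * l1)}. \<tau> \<in> P e \<and> \<tau> \<in> Q e"
      by auto
  qed (use K0 l1 in auto)
qed

subsection \<open>Recovering a function from its Laplace transform\<close>

text \<open>Combinations of \<open>exp (- j * \<tau>)\<close> with \<open>j \<ge> 1\<close> are
  \<open>exp (- \<tau>)\<close> times polynomials in \<open>exp (- \<tau>)\<close>. By Weierstrass
  they approximate a narrow hat function at \<open>ln 2\<close>, against which a Lipschitz function
  averages to nearly its value there. The hat and the polynomial depend on \<epsilon> and
  \<open>C\<close> alone, so \<open>N\<close> and \<delta> serve all \<open>f\<close>,
  \<open>a\<close> and \<open>b\<close>.\<close>

lemma laplace_tauberian:
  assumes "\<epsilon> > 0" "C \<ge> 0"
  obtains N :: nat and \<delta> where "\<delta> > 0"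
    "\<And>(f :: real \<Rightarrow> 'a::banach) a b. 0 < a \<Longrightarrow> a \<le> 1 / 2 \<Longrightarrow> 1 \<le> b \<Longrightarrow> continuous_on {a..b} f \<Longrightarrow>
       (\<And>x. x \<in> {a..b} \<Longrightarrow> norm (f x) \<le> C) \<Longrightarrow>
       (\<And>x y. x \<in> {1/2..1} \<Longrightarrow> y \<in> {1/2..1} \<Longrightarrow> norm (f x - f y) \<le> C * \<bar>x - y\<bar>) \<Longrightarrow>
       (\<And>j. j \<in> {1..N} \<Longrightarrow> norm (integral {a..b} (\<lambda>\<tau>. exp (- (real j * \<tau>)) *\<^sub>R f \<tau>)) \<le> \<delta>) \<Longrightarrow>
       norm (f (ln 2)) \<le> \<epsilon>"
proof -
  \<comment> \<open>\<open>r\<close> is the half-width of the hat: \<open>1 / 8\<close> keeps its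
    support inside \<open>{1/2..1}\<close>, where \<open>f\<close> is Lipschitz, and the other bound
    keeps the variation of \<open>f\<close> there below \<open>\<epsilon> / 2\<close>.\<close>
  define r where "r = min (1 / 8) (\<epsilon> / (2 * (C + 1)))"
  have r: "0 < r" "r \<le> 1 / 8" "C * r \<le> \<epsilon> / 2"
  proof -
    show "0 < r" using assms by (auto simp: r_def)
    show "r \<le> 1 / 8" unfolding r_def by (rule min.cobounded1)
    have "C * r \<le> C * (\<epsilon> / (2 * (C + 1)))"
      using assms by (intro mult_left_mono) (auto simp: r_def)
    also have "\<dots> \<le> \<epsilon> / 2"
      using assms by (simp add: field_simps)
    finally show "C * r \<le> \<epsilon> / 2" .
  qed
  define \<psi> where "\<psi> \<tau> = max 0 (r - \<bar>\<tau> - ln 2\<bar>)" for \<tau> :: real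
  have \<psi>_cont: "continuous_on S \<psi>" for S
    unfolding \<psi>_def by (intro continuous_intros)
  have \<psi>_nonneg: "0 \<le> \<psi> \<tau>" for \<tau> by (simp add: \<psi>_def)
  have ln2: "2 / 3 \<le> ln (2::real)" "ln (2::real) \<le> 25 / 36"
    using ln2_ge_two_thirds ln2_le_25_over_36 by auto
  have \<psi>_supp: "\<psi> \<tau> = 0" if "\<tau> \<notin> {1/2..1}" for \<tau>
    using that ln2 r by (auto simp: \<psi>_def)
  \<comment> \<open>In the variable \<open>x = exp (- \<tau>)\<close>, this is the hat divided by
    \<open>x\<close>. Truncating at \<open>1 / 8\<close> makes it continuous at 0 and changes
    nothing, since the hat vanishes for \<open>\<tau> \<ge> 3 * ln 2\<close>.\<close>
  define \<phi> where "\<phi> x = \<psi> (- ln (max x (1 / 8))) / max x (1 / 8)" for x :: real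
  have ln8: "ln (1 / 8 :: real) = - 3 * ln 2"
    using ln_realpow[of 2 3] by (simp add: ln_div)
  have \<phi>_exp: "exp (- \<tau>) * \<phi> (exp (- \<tau>)) = \<psi> \<tau>" for \<tau>
  proof (cases "exp (- \<tau>) \<ge> 1 / 8")
    case True
    then have "max (exp (- \<tau>)) (1 / 8) = exp (- \<tau>)" by (rule max_absorb1)
    then show ?thesis by (simp add: \<phi>_def)
  next
    case False
    then have "exp (- \<tau>) < exp (ln (1 / 8))" by simp
    then have "- \<tau> < ln (1 / 8)" by (simp only: exp_less_cancel_iff)
    then have "\<tau> > 3 * ln 2" by (simp add: ln8)
    then have "\<psi> \<tau> = 0" using ln2 by (intro \<psi>_supp) auto
    moreover have "\<psi> (- ln (1 / 8)) = 0" using ln2 by (intro \<psi>_supp) (auto simp: ln8)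
    ultimately show ?thesis using False by (simp add: \<phi>_def max_def)
  qed
  have \<phi>_cont: "continuous_on {0..1} \<phi>"
    unfolding \<phi>_def by (intro continuous_intros continuous_on_compose2[OF \<psi>_cont[of UNIV]]) auto
  \<comment> \<open>The factor \<open>r\<^sup>2\<close> here and in \<delta> matches the lower bound
    \<open>r\<^sup>2 / 2\<close> for the integral \<open>W\<close> of the hat, so that each of the
    two errors costs at most \<open>W * (\<epsilon> / 4)\<close>.\<close>
  define \<kappa> where "\<kappa> = \<epsilon> * r\<^sup>2 / (8 * (C + 1))"
  have "\<kappa> > 0" using assms r by (simp add: \<kappa>_def)
  with \<phi>_cont obtain g where g: "real_polynomial_function g"
      "\<And>x. x \<in> {0..1} \<Longrightarrow> \<bar>\<phi> x - g x\<bar> < \<kappa>"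
    using Stone_Weierstrass_real_polynomial_function[of "{0..1}" \<phi> \<kappa>] by auto
  then obtain c n where c: "g = (\<lambda>x. \<Sum>i\<le>n. c i * x ^ i)"
    using real_polynomial_function_iff_sum by auto
  define c1 where "c1 = (\<Sum>i\<le>n. \<bar>c i\<bar>)"
  have c1: "c1 \<ge> 0" by (auto simp: c1_def intro: sum_nonneg)
  define \<delta> where "\<delta> = \<epsilon> * r\<^sup>2 / (8 * (c1 + 1))"
  have \<delta>: "\<delta> > 0" using assms r c1 by (simp add: \<delta>_def)
  show thesis
  proof (rule that[OF \<delta>, of "Suc n"])
    fix f :: "real \<Rightarrow> 'a" and a b :: real
    assume ab: "0 < a" "a \<le> 1 / 2" "1 \<le> b" and cont [continuous_intros]: "continuous_on {a..b} f"
      and bound: "\<And>x. x \<in> {a..b} \<Longrightarrow> norm (f x) \<le> C"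
      and lip: "\<And>x y. x \<in> {1/2..1} \<Longrightarrow> y \<in> {1/2..1} \<Longrightarrow> norm (f x - f y) \<le> C * \<bar>x - y\<bar>"
      and small: "\<And>j. j \<in> {1..Suc n} \<Longrightarrow>
         norm (integral {a..b} (\<lambda>\<tau>. exp (- (real j * \<tau>)) *\<^sub>R f \<tau>)) \<le> \<delta>"
    note [continuous_intros] = \<psi>_cont
    have "continuous_on UNIV g" unfolding c by (intro continuous_intros)
    then have g_cont: "continuous_on S (\<lambda>\<tau>. g (exp (- \<tau>)))" for S
      by (rule continuous_on_compose2) (auto intro!: continuous_intros)
    note [continuous_intros] = g_cont
    define W where "W = integral {a..b} \<psi>"
    \<comment> \<open>On the middle half of its support the hat is at least half its height.\<close>
    have "integral {ln 2 - r / 2..ln 2 + r / 2} (\<lambda>_. r / 2) \<le> integral {ln 2 - r / 2..ln 2 + r / 2} \<psi>"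
    proof (intro integral_le integrable_continuous_real continuous_intros)
      fix \<tau> assume "\<tau> \<in> {ln 2 - r / 2..ln 2 + r / 2}"
      then have "\<bar>\<tau> - ln 2\<bar> \<le> r / 2" unfolding abs_le_iff atLeastAtMost_iff by linarith
      then show "r / 2 \<le> \<psi> \<tau>" unfolding \<psi>_def by linarith
    qed
    also have "\<dots> \<le> W"
      unfolding W_def using ln2 ab r
      by (intro integral_subset_le integrable_continuous_real continuous_intros) (auto intro: \<psi>_nonneg)
    finally have W: "r\<^sup>2 / 2 \<le> W" using r by (simp add: power2_eq_square)
    have poly: "integral {a..b} (\<lambda>\<tau>. (exp (- \<tau>) * g (exp (- \<tau>))) *\<^sub>R f \<tau>)
        = (\<Sum>i\<le>n. c i *\<^sub>R integral {a..b} (\<lambda>\<tau>. exp (- (real (Suc i) * \<tau>)) *\<^sub>R f \<tau>))"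
    proof -
      have "(exp (- \<tau>) * g (exp (- \<tau>))) *\<^sub>R f \<tau>
          = (\<Sum>i\<le>n. c i *\<^sub>R (exp (- (real (Suc i) * \<tau>)) *\<^sub>R f \<tau>))" for \<tau>
      proof -
        have "exp (- (real (Suc i) * \<tau>)) = exp (- \<tau>) * exp (- \<tau>) ^ i" for i
          using exp_of_nat_mult[of "Suc i" "- \<tau>"] by (simp del: of_nat_Suc exp_minus)
        then show ?thesis
          by (simp only: c sum_distrib_left scaleR_sum_left scaleR_scaleR) (simp only: mult_ac)
      qed
      then have "integral {a..b} (\<lambda>\<tau>. (exp (- \<tau>) * g (exp (- \<tau>))) *\<^sub>R f \<tau>)
          = integral {a..b} (\<lambda>\<tau>. \<Sum>i\<le>n. c i *\<^sub>R (exp (- (real (Suc i) * \<tau>)) *\<^sub>R f \<tau>))"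
        by (simp only:)
      also have "\<dots> = (\<Sum>i\<le>n. integral {a..b} (\<lambda>\<tau>. c i *\<^sub>R (exp (- (real (Suc i) * \<tau>)) *\<^sub>R f \<tau>)))"
        by (rule integral_sum) (auto intro!: integrable_continuous_real continuous_intros)
      finally show ?thesis by (simp only: integral_cmul)
    qed
    have "norm (integral {a..b} (\<lambda>\<tau>. (exp (- \<tau>) * g (exp (- \<tau>))) *\<^sub>R f \<tau>)) \<le> (\<Sum>i\<le>n. \<bar>c i\<bar> * \<delta>)"
      unfolding poly
    proof (rule sum_norm_le)
      fix i assume "i \<in> {..n}"
      then have "Suc i \<in> {1..Suc n}" by auto
      then show "norm (c i *\<^sub>R integral {a..b} (\<lambda>\<tau>. exp (- (real (Suc i) * \<tau>)) *\<^sub>R f \<tau>)) \<le> \<bar>c i\<bar> * \<delta>"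
        unfolding norm_scaleR by (intro mult_left_mono small abs_ge_zero)
    qed
    then have 1: "norm (integral {a..b} (\<lambda>\<tau>. (exp (- \<tau>) * g (exp (- \<tau>))) *\<^sub>R f \<tau>)) \<le> c1 * \<delta>"
      by (simp add: c1_def sum_distrib_right)
    have int_exp: "((\<lambda>\<tau>. exp (- \<tau>)) has_integral (- exp (- b) - (- exp (- a)))) {a..b}"
      using ab by (intro fundamental_theorem_of_calculus)
        (auto intro!: derivative_eq_intros simp flip: has_real_derivative_iff_has_vector_derivative)
    have "norm (integral {a..b} (\<lambda>\<tau>. \<psi> \<tau> *\<^sub>R f \<tau>) -
        integral {a..b} (\<lambda>\<tau>. (exp (- \<tau>) * g (exp (- \<tau>))) *\<^sub>R f \<tau>))
      = norm (integral {a..b} (\<lambda>\<tau>. (exp (- \<tau>) * (\<phi> (exp (- \<tau>)) - g (exp (- \<tau>)))) *\<^sub>R f \<tau>))"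
      unfolding \<phi>_exp right_diff_distrib scaleR_left_diff_distrib
      by (subst integral_diff) (auto intro!: integrable_continuous_real continuous_intros)
    also have "\<dots> \<le> integral {a..b} (\<lambda>\<tau>. exp (- \<tau>) * (\<kappa> * C))"
    proof (rule integral_norm_bound_integral)
      have "continuous_on {a..b} (\<lambda>\<tau>. (exp (- \<tau>) * (\<phi> (exp (- \<tau>)) - g (exp (- \<tau>)))) *\<^sub>R f \<tau>)"
        unfolding right_diff_distrib \<phi>_exp by (intro continuous_intros)
      then show "(\<lambda>\<tau>. (exp (- \<tau>) * (\<phi> (exp (- \<tau>)) - g (exp (- \<tau>)))) *\<^sub>R f \<tau>) integrable_on {a..b}"
        by (rule integrable_continuous_real)
      show "(\<lambda>\<tau>. exp (- \<tau>) * (\<kappa> * C)) integrable_on {a..b}"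
        by (intro integrable_continuous_real continuous_intros)
      fix \<tau> assume \<tau>: "\<tau> \<in> {a..b}"
      have "\<bar>\<phi> (exp (- \<tau>)) - g (exp (- \<tau>))\<bar> * norm (f \<tau>) \<le> \<kappa> * C"
        using \<tau> ab \<open>\<kappa> > 0\<close> by (intro mult_mono less_imp_le[OF g(2)] bound) auto
      then show "norm ((exp (- \<tau>) * (\<phi> (exp (- \<tau>)) - g (exp (- \<tau>)))) *\<^sub>R f \<tau>) \<le> exp (- \<tau>) * (\<kappa> * C)"
        by (simp add: abs_mult mult.assoc)
    qed
    also have "\<dots> = (exp (- a) - exp (- b)) * (\<kappa> * C)"
      using has_integral_mult_left[OF int_exp, of "\<kappa> * C"] by (intro integral_unique) simp
    also have "\<dots> \<le> 1 * (\<kappa> * C)"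
    proof (intro mult_right_mono)
      have "exp (- a) \<le> 1" "0 < exp (- b)" using ab by auto
      then show "exp (- a) - exp (- b) \<le> 1" by linarith
    qed (use \<open>\<kappa> > 0\<close> assms in auto)
    finally have 2: "norm (integral {a..b} (\<lambda>\<tau>. \<psi> \<tau> *\<^sub>R f \<tau>) -
        integral {a..b} (\<lambda>\<tau>. (exp (- \<tau>) * g (exp (- \<tau>))) *\<^sub>R f \<tau>)) \<le> \<kappa> * C" by simp
    have "norm (integral {a..b} (\<lambda>\<tau>. \<psi> \<tau> *\<^sub>R f (ln 2)) - integral {a..b} (\<lambda>\<tau>. \<psi> \<tau> *\<^sub>R f \<tau>))
      = norm (integral {a..b} (\<lambda>\<tau>. \<psi> \<tau> *\<^sub>R (f (ln 2) - f \<tau>)))"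
      unfolding scaleR_right_diff_distrib
      by (subst integral_diff) (auto intro!: integrable_continuous_real continuous_intros)
    also have "\<dots> \<le> integral {a..b} (\<lambda>\<tau>. \<psi> \<tau> * (C * r))"
    proof (intro integral_norm_bound_integral integrable_continuous_real continuous_intros)
      fix \<tau> assume "\<tau> \<in> {a..b}"
      show "norm (\<psi> \<tau> *\<^sub>R (f (ln 2) - f \<tau>)) \<le> \<psi> \<tau> * (C * r)"
      proof (cases "\<psi> \<tau> = 0")
        case False
        then have "\<tau> \<in> {1/2..1}" "\<bar>ln 2 - \<tau>\<bar> \<le> r" using \<psi>_supp[of \<tau>] by (auto simp: \<psi>_def max_def split: if_splits)
        then have "norm (f (ln 2) - f \<tau>) \<le> C * r"
          using ln2 assms by (intro order_trans[OF lip] mult_left_mono) auto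
        then show ?thesis using \<psi>_nonneg[of \<tau>] by (simp add: mult_left_mono)
      qed simp
    qed
    also have "\<dots> = W * (C * r)" by (simp add: W_def)
    finally have *: "norm (integral {a..b} (\<lambda>\<tau>. \<psi> \<tau> *\<^sub>R f (ln 2)) - integral {a..b} (\<lambda>\<tau>. \<psi> \<tau> *\<^sub>R f \<tau>)) \<le> W * (C * r)" .
    have 3: "norm (W *\<^sub>R f (ln 2) - integral {a..b} (\<lambda>\<tau>. \<psi> \<tau> *\<^sub>R f \<tau>)) \<le> W * (C * r)"
    proof -
      have "integral {a..b} (\<lambda>\<tau>. \<psi> \<tau> *\<^sub>R f (ln 2)) = W *\<^sub>R f (ln 2)"
        unfolding W_def
        by (intro integral_unique has_integral_scaleR_left integrable_integral integrable_continuous_real \<psi>_cont)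
      then show ?thesis using * by simp
    qed
    have Wpos: "W > 0" using W r by (smt (verit) zero_less_power half_gt_zero)
    have "W * norm (f (ln 2)) = norm (W *\<^sub>R f (ln 2))" using Wpos by simp
    also have "\<dots> \<le> W * (C * r) + \<kappa> * C + c1 * \<delta>"
      using norm_triangle_ineq[of "W *\<^sub>R f (ln 2) - integral {a..b} (\<lambda>\<tau>. \<psi> \<tau> *\<^sub>R f \<tau>)" "integral {a..b} (\<lambda>\<tau>. \<psi> \<tau> *\<^sub>R f \<tau>)"]
        norm_triangle_ineq[of "integral {a..b} (\<lambda>\<tau>. \<psi> \<tau> *\<^sub>R f \<tau>) -
        integral {a..b} (\<lambda>\<tau>. (exp (- \<tau>) * g (exp (- \<tau>))) *\<^sub>R f \<tau>)" "integral {a..b} (\<lambda>\<tau>. (exp (- \<tau>) * g (exp (- \<tau>))) *\<^sub>R f \<tau>)"]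
        1 2 3 by simp
    \<comment> \<open>The three errors come from the variation of \<open>f\<close> under the hat,
      from the polynomial approximation, and from the Laplace transforms.\<close>
    also have "\<dots> \<le> W * (\<epsilon> / 2) + W * (\<epsilon> / 4) + W * (\<epsilon> / 4)"
    proof (intro add_mono mult_left_mono r)
      have *: "\<epsilon> * r\<^sup>2 / 8 \<le> W * (\<epsilon> / 4)"
        using mult_left_mono[OF W, of "\<epsilon> / 4"] assms by (simp add: field_simps)
      have "\<kappa> * C \<le> \<epsilon> * r\<^sup>2 / 8"
        using assms by (simp add: \<kappa>_def field_simps)
      then show "\<kappa> * C \<le> W * (\<epsilon> / 4)" using * by simp
      have "c1 * \<delta> \<le> \<epsilon> * r\<^sup>2 / 8"
        using assms c1 by (simp add: \<delta>_def field_simps)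
      then show "c1 * \<delta> \<le> W * (\<epsilon> / 4)" using * by simp
    qed (use Wpos in auto)
    also have "\<dots> = W * \<epsilon>" by (simp add: field_simps)
    finally show "norm (f (ln 2)) \<le> \<epsilon>" using Wpos by simp
  qed
qed

subsection \<open>Norm continuity of parabolic evolution systems\<close>

text \<open>
  \<open>R l s\<close> is the resolvent at \<open>l\<close> of the shifted generator at time \<open>s\<close>, and \<open>R_V\<close> expresses
  that \<open>\<partial>\<^sub>t U(t,s)\<close> is close to this frozen generator applied to \<open>U(t,s)\<close>.
\<close>

locale parabolic_evolution =
  fixes U V R :: "real \<Rightarrow> real \<Rightarrow> ('a::banach \<Rightarrow>\<^sub>L 'a)"
    and M \<omega> C K \<omega>\<^sub>0 \<mu> \<nu> :: real
  assumes const_pos: "0 < M" "0 < \<omega>" "0 \<le> C" "0 \<le> K" "0 \<le> \<omega>\<^sub>0" "0 < \<mu>" "0 < \<nu>" "1 < \<mu> + \<nu>"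
    and U_comp: "s \<le> r \<Longrightarrow> r \<le> t \<Longrightarrow> U t s = U t r o\<^sub>L U r s"
    and U_bound: "s \<le> t \<Longrightarrow> norm (U t s) \<le> M * exp (- \<omega> * (t - s))"
    and U_deriv: "s < t \<Longrightarrow> ((\<lambda>r. U r s) has_vector_derivative V t s) (at t)"
    and V_bound: "s < t \<Longrightarrow> t \<le> s + 1 \<Longrightarrow> norm (V t s) \<le> C / (t - s)"
    and R_bound: "0 < l \<Longrightarrow> norm (R l s) \<le> K / l"
    and R_V: "0 < l \<Longrightarrow> s < t \<Longrightarrow> t \<le> s + 1 \<Longrightarrow>
      norm (R l s (V t s x) - (l + \<omega>\<^sub>0) *\<^sub>R R l s (U t s x) + U t s x)
        \<le> K * (t - s) powr (\<mu> - 1) * l powr (- \<nu>) * norm x"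
    and R_change: "0 < l \<Longrightarrow> norm (R l r y) \<le> K * (norm (R 1 s y) + \<bar>r - s\<bar> powr \<mu> * norm y)"
    and R_lim: "0 < l \<Longrightarrow> ((\<lambda>t. R l s (U t s x)) \<longlongrightarrow> R l s x) (at_right s)"
begin

section \<open>Elementary bounds and derivatives\<close>

lemma U_bound_const: "s \<le> t \<Longrightarrow> norm (U t s) \<le> M"
  using U_bound[of s t] const_pos by (smt (verit) exp_le_one_iff mult_left_le mult_nonneg_nonneg mult_minus_left)

lemma U_apply_bound: "s \<le> t \<Longrightarrow> norm (U t s x) \<le> M * norm x"
  by (rule order_trans[OF norm_blinfun]) (intro mult_right_mono U_bound_const norm_ge_zero)

lemma R_apply_bound: "0 < l \<Longrightarrow> norm (R l s x) \<le> K / l * norm x"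
  by (rule order_trans[OF norm_blinfun]) (intro mult_right_mono R_bound norm_ge_zero)

lemma R_U_bound: "0 < l \<Longrightarrow> s \<le> t \<Longrightarrow> norm (R l r (U t s x)) \<le> K / l * (M * norm x)"
  by (rule order_trans[OF R_apply_bound], assumption, rule mult_left_mono[OF U_apply_bound])
    (use const_pos in auto)

lemma U_apply_deriv: "s < t \<Longrightarrow> ((\<lambda>r. U r s x) has_vector_derivative V t s x) (at t)"
  by (rule bounded_linear.has_vector_derivative[OF blinfun.bounded_linear_left U_deriv])

lemma U_apply_cont: "continuous_on {s<..} (\<lambda>r. U r s x)"
  by (intro continuous_at_imp_continuous_on ballI)
     (rule has_vector_derivative_continuous[OF U_apply_deriv], simp)

lemma R_U_deriv: "s < t \<Longrightarrow> ((\<lambda>r. R l q (U r s x)) has_vector_derivative R l q (V t s x)) (at t)"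
  by (rule bounded_linear.has_vector_derivative[OF blinfun.bounded_linear_right U_apply_deriv])

text \<open>Mean value inequality: at distance at least \<open>d\<close> from the diagonal the
  singular bound \<open>C / (t - s)\<close> on the derivative is at most
  \<open>C / d\<close>.\<close>

lemma U_lipschitz:
  assumes "0 < d" "s + d \<le> t" "t \<le> t'" "t' \<le> s + 1"
  shows "norm (U t' s - U t s) \<le> C / d * (t' - t)"
proof (cases "t = t'")
  case False
  have "norm (U t' s - U t s) \<le> C / d * t' - C / d * t"
  proof (rule differentiable_bound_general[where f = "\<lambda>t. U t s" and \<phi> = "\<lambda>t. C / d * t"
        and f' = "\<lambda>t. V t s" and \<phi>' = "\<lambda>_. C / d"])
    show "continuous_on {t..t'} (\<lambda>t. U t s)"
      using assms by (intro continuous_at_imp_continuous_on ballI has_vector_derivative_continuous[OF U_deriv]) auto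
    show "norm (V x s) \<le> C / d" if "t < x" "x < t'" for x
      using that assms const_pos by (intro order_trans[OF V_bound] divide_left_mono) auto
  qed (use assms False in \<open>auto intro!: U_deriv continuous_intros derivative_eq_intros\<close>)
  then show ?thesis by (simp add: right_diff_distrib)
qed simp

text \<open>By \<open>R_V\<close> at \<open>l = 1\<close>, the derivative of
  \<open>R 1 s (U t s x)\<close> is of order \<open>(t - s) powr (\<mu> - 1)\<close>, an integrable
  singularity even where that of \<open>U t s x\<close> is not. The function \<phi> in the proof is
  a primitive of this bound.\<close>

lemma resolvent_increment:
  assumes h: "0 < h" "h \<le> 1"
  shows "norm (R 1 s (U (s + h) s x - x)) \<le> (K * h powr \<mu> / \<mu> + ((1 + \<omega>\<^sub>0) * K + 1) * M * h) * norm x"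
proof -
  define c where "c = ((1 + \<omega>\<^sub>0) * K + 1) * M"
  have c: "0 \<le> c" using const_pos by (auto simp: c_def)
  define f where "f t = R 1 s (U t s x)" for t
  define \<phi> where "\<phi> t = (K * (t - s) powr \<mu> / \<mu> + c * (t - s)) * norm x" for t
  have bound: "norm (R 1 s (V t s x)) \<le> (K * (t - s) powr (\<mu> - 1) + c) * norm x"
    if "s < t" "t \<le> s + 1" for t
  proof -
    have "norm (R 1 s (V t s x)) \<le> norm (R 1 s (V t s x) - (1 + \<omega>\<^sub>0) *\<^sub>R R 1 s (U t s x) + U t s x)
        + (norm ((1 + \<omega>\<^sub>0) *\<^sub>R R 1 s (U t s x)) + norm (U t s x))"
      using norm_triangle_ineq[of "R 1 s (V t s x) - (1 + \<omega>\<^sub>0) *\<^sub>R R 1 s (U t s x) + U t s x"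
          "(1 + \<omega>\<^sub>0) *\<^sub>R R 1 s (U t s x) - U t s x"]
        norm_triangle_ineq4[of "(1 + \<omega>\<^sub>0) *\<^sub>R R 1 s (U t s x)" "U t s x"] by simp
    also have "\<dots> \<le> K * (t - s) powr (\<mu> - 1) * 1 powr (- \<nu>) * norm x
        + ((1 + \<omega>\<^sub>0) * (K / 1 * (M * norm x)) + M * norm x)"
    proof (intro add_mono R_V U_apply_bound)
      show "norm ((1 + \<omega>\<^sub>0) *\<^sub>R R 1 s (U t s x)) \<le> (1 + \<omega>\<^sub>0) * (K / 1 * (M * norm x))"
        using mult_left_mono[OF R_U_bound[of 1 s t s x], of "1 + \<omega>\<^sub>0"] that const_pos by simp
    qed (use that in auto)
    finally show ?thesis by (simp add: c_def algebra_simps)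
  qed
  have diff: "norm (f (s + h) - f t) \<le> \<phi> (s + h)" if t: "s < t" "t < s + h" for t
  proof -
    have "norm (f (s + h) - f t) \<le> \<phi> (s + h) - \<phi> t"
    proof (rule differentiable_bound_general[where f' = "\<lambda>t. R 1 s (V t s x)"
          and \<phi>' = "\<lambda>t. (K * (t - s) powr (\<mu> - 1) + c) * norm x"])
      show "continuous_on {t..s + h} f"
        unfolding f_def using t
        by (intro continuous_at_imp_continuous_on ballI has_vector_derivative_continuous[OF R_U_deriv]) auto
      show "continuous_on {t..s + h} \<phi>"
        unfolding \<phi>_def using t const_pos by (intro continuous_intros) auto
      show "(\<phi> has_vector_derivative (K * (u - s) powr (\<mu> - 1) + c) * norm x) (at u)" if "t < u" for u
        unfolding \<phi>_def has_real_derivative_iff_has_vector_derivative[symmetric] using t that const_pos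
        by (auto intro!: derivative_eq_intros)
    qed (use t h in \<open>auto simp: f_def intro!: R_U_deriv bound\<close>)
    moreover have "0 \<le> \<phi> t" unfolding \<phi>_def using const_pos c t by auto
    ultimately show ?thesis by simp
  qed
  \<comment> \<open>The estimate is proved from \<open>t > s\<close> on and then \<open>t\<close>
    tends to \<open>s\<close>; the initial value is attained after applying the resolvent, by
    \<open>R_lim\<close>.\<close>
  have "((\<lambda>t. norm (f (s + h) - f t)) \<longlongrightarrow> norm (f (s + h) - R 1 s x)) (at_right s)"
    unfolding f_def by (intro tendsto_intros R_lim) simp
  moreover have "eventually (\<lambda>t. norm (f (s + h) - f t) \<le> \<phi> (s + h)) (at_right s)"
    using diff h by (auto simp: eventually_at_right_field intro!: exI[of _ "s + h"])
  ultimately have "norm (f (s + h) - R 1 s x) \<le> \<phi> (s + h)"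
    by (rule tendsto_upperbound) simp
  then show ?thesis by (simp add: f_def \<phi>_def c_def blinfun.diff_right)
qed

text \<open>For \<open>l = j / \<eta>\<close>, the quantity \<Psi>, a discounted resolvent image
  plus \<eta> times the Laplace integral, would be constant for a frozen generator. Its derivative
  is the defect controlled by \<open>R_V\<close>, up to a term in \<open>\<omega>\<^sub>0\<close>.
  Hence the integral is close to the resolvent at the starting time \<open>a\<close>, divided by
  \<eta>.\<close>

lemma laplace_bound:
  assumes j: "1 \<le> j" and \<eta>: "0 < \<eta>" and ab: "0 < a" "a < b" "\<eta> * b \<le> 1"
  shows "norm (integral {a..b} (\<lambda>\<tau>. exp (- (j * \<tau>)) *\<^sub>R U (r + \<eta> * \<tau>) r y))
    \<le> (K * \<eta> powr (\<mu> + \<nu> - 1) * b powr \<mu> / \<mu> + \<omega>\<^sub>0 * K * M * \<eta> * b + exp (- b) * K * M) * norm y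
      + norm (R (j / \<eta>) r (U (r + \<eta> * a) r y)) / \<eta>"
proof -
  define l where "l = j / \<eta>"
  have l: "0 < l" using j \<eta> by (auto simp: l_def)
  \<comment> \<open>As \<open>j \<ge> 1\<close>, all the resolvents involved have norm at most
    \<open>K * \<eta>\<close>, uniformly in \<open>j\<close>.\<close>
  have Kl: "K / l \<le> K * \<eta>"
  proof -
    have "K * \<eta> * 1 \<le> K * \<eta> * j"
      using j \<eta> const_pos by (intro mult_left_mono) auto
    then show ?thesis using j \<eta> by (simp add: l_def field_simps)
  qed
  define f where "f \<tau> = U (r + \<eta> * \<tau>) r y" for \<tau>
  define g where "g \<tau> = R l r (f \<tau>)" for \<tau>
  define I where "I \<tau> = integral {a..\<tau>} (\<lambda>\<tau>. exp (- (j * \<tau>)) *\<^sub>R f \<tau>)" for \<tau>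
  define \<Psi> where "\<Psi> \<tau> = exp (- (j * \<tau>)) *\<^sub>R g \<tau> + \<eta> *\<^sub>R I \<tau>" for \<tau>
  \<comment> \<open>A primitive of the bound on the derivative of \<Psi>; the exponent
    \<open>\<mu> - 1\<close> is integrable at 0.\<close>
  define \<phi> where "\<phi> \<tau> = \<eta> * ((K * \<eta> powr (\<mu> + \<nu> - 1) * \<tau> powr \<mu> / \<mu> + \<omega>\<^sub>0 * K * M * \<eta> * \<tau>) * norm y)" for \<tau>
  have f_deriv: "(f has_vector_derivative \<eta> *\<^sub>R V (r + \<eta> * \<tau>) r y) (at \<tau>)" if "0 < \<tau>" for \<tau>
  proof -
    have "((\<lambda>\<tau>. r + \<eta> * \<tau>) has_vector_derivative \<eta>) (at \<tau>)"
      by (auto intro!: derivative_eq_intros simp flip: has_real_derivative_iff_has_vector_derivative)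
    then have "((\<lambda>\<tau>. U (r + \<eta> * \<tau>) r y) has_vector_derivative \<eta> *\<^sub>R V (r + \<eta> * \<tau>) r y) (at \<tau>)"
      using vector_diff_chain_at[of "\<lambda>\<tau>. r + \<eta> * \<tau>" \<eta> \<tau> "\<lambda>t. U t r y" "V (r + \<eta> * \<tau>) r y"]
        U_apply_deriv[of r "r + \<eta> * \<tau>" y] that \<eta>
      by (simp add: o_def)
    then show ?thesis by (simp add: f_def[abs_def])
  qed
  have g_deriv: "(g has_vector_derivative \<eta> *\<^sub>R R l r (V (r + \<eta> * \<tau>) r y)) (at \<tau>)" if "0 < \<tau>" for \<tau>
    using bounded_linear.has_vector_derivative[OF blinfun.bounded_linear_right f_deriv[OF that], of "R l r"]
    by (simp add: g_def[abs_def] blinfun.scaleR_right)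
  have f_cont: "continuous_on {a..b} f"
    using ab by (intro continuous_at_imp_continuous_on ballI has_vector_derivative_continuous[OF f_deriv]) auto
  have g_cont: "continuous_on {a..b} g"
    using ab by (intro continuous_at_imp_continuous_on ballI has_vector_derivative_continuous[OF g_deriv]) auto
  have I_deriv: "(I has_vector_derivative exp (- (j * \<tau>)) *\<^sub>R f \<tau>) (at \<tau> within {a..b})" if "\<tau> \<in> {a..b}" for \<tau>
    unfolding I_def[abs_def] using that
    by (intro integral_has_vector_derivative continuous_intros f_cont)
  have I_cont: "continuous_on {a..b} I"
    unfolding continuous_on_eq_continuous_within
    by (intro ballI has_vector_derivative_continuous[OF I_deriv])
  have \<Psi>_deriv: "(\<Psi> has_vector_derivative (exp (- (j * \<tau>)) * \<eta>) *\<^sub>R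
      (R l r (V (r + \<eta> * \<tau>) r y) - l *\<^sub>R g \<tau> + f \<tau>)) (at \<tau>)" if \<tau>: "a < \<tau>" "\<tau> < b" for \<tau>
  proof -
    have "(I has_vector_derivative exp (- (j * \<tau>)) *\<^sub>R f \<tau>) (at \<tau>)"
      using I_deriv[of \<tau>] \<tau> by (simp add: at_within_Icc_at)
    then have "(\<Psi> has_vector_derivative (exp (- (j * \<tau>)) *\<^sub>R (\<eta> *\<^sub>R R l r (V (r + \<eta> * \<tau>) r y))
        + (- (j * exp (- (j * \<tau>)))) *\<^sub>R g \<tau>) + \<eta> *\<^sub>R (exp (- (j * \<tau>)) *\<^sub>R f \<tau>)) (at \<tau>)"
      unfolding \<Psi>_def[abs_def] using \<tau> ab
      by (auto intro!: derivative_eq_intros g_deriv)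
    moreover have "j = \<eta> * l" using \<eta> by (simp add: l_def)
    ultimately show ?thesis by (simp add: algebra_simps)
  qed
  have \<phi>_deriv: "(\<phi> has_vector_derivative \<eta> * ((K * \<eta> powr (\<mu> + \<nu> - 1) * \<tau> powr (\<mu> - 1) + \<omega>\<^sub>0 * K * M * \<eta>) * norm y))
      (at \<tau>)" if "0 < \<tau>" for \<tau>
    unfolding \<phi>_def has_real_derivative_iff_has_vector_derivative[symmetric] using that const_pos
    by (auto intro!: derivative_eq_intros)
  have bound: "norm ((exp (- (j * \<tau>)) * \<eta>) *\<^sub>R (R l r (V (r + \<eta> * \<tau>) r y) - l *\<^sub>R g \<tau> + f \<tau>))
      \<le> \<eta> * ((K * \<eta> powr (\<mu> + \<nu> - 1) * \<tau> powr (\<mu> - 1) + \<omega>\<^sub>0 * K * M * \<eta>) * norm y)"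
    if \<tau>: "a < \<tau>" "\<tau> < b" for \<tau>
  proof -
    have pos: "0 < \<tau>" "0 < \<eta> * \<tau>" "\<eta> * \<tau> \<le> 1"
      using \<tau> ab \<eta> mult_left_mono[of \<tau> b \<eta>] by (auto intro: order_trans[of _ "\<eta> * b"])
    \<comment> \<open>Together with \<open>(\<eta> * \<tau>) powr (\<mu> - 1)\<close> this yields
      \<eta> to the power \<open>\<mu> + \<nu> - 1\<close>, which is positive by the
      Acquistapace--Terreni condition, so the defect vanishes as \<eta> tends to 0.\<close>
    have "l powr (- \<nu>) \<le> (1 / \<eta>) powr (- \<nu>)"
      using j \<eta> const_pos by (intro powr_mono2') (auto simp: l_def divide_right_mono)
    also have "\<dots> = \<eta> powr \<nu>"
      using \<eta> by (simp add: powr_divide powr_minus_divide)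
    finally have l\<nu>: "l powr (- \<nu>) \<le> \<eta> powr \<nu>" .
    have E: "norm (R l r (V (r + \<eta> * \<tau>) r y) - (l + \<omega>\<^sub>0) *\<^sub>R g \<tau> + f \<tau>)
        \<le> K * (\<eta> * \<tau>) powr (\<mu> - 1) * l powr (- \<nu>) * norm y"
      unfolding g_def f_def using R_V[of l r "r + \<eta> * \<tau>" y] l pos by simp
    also have "\<dots> \<le> K * (\<eta> * \<tau>) powr (\<mu> - 1) * \<eta> powr \<nu> * norm y"
      using const_pos by (intro mult_right_mono mult_left_mono l\<nu>) auto
    also have "\<dots> = K * \<eta> powr (\<mu> + \<nu> - 1) * \<tau> powr (\<mu> - 1) * norm y"
      using \<eta> pos by (simp add: powr_mult powr_add[symmetric] algebra_simps)
    finally have E: "norm (R l r (V (r + \<eta> * \<tau>) r y) - (l + \<omega>\<^sub>0) *\<^sub>R g \<tau> + f \<tau>)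
        \<le> K * \<eta> powr (\<mu> + \<nu> - 1) * \<tau> powr (\<mu> - 1) * norm y" .
    have "norm (g \<tau>) \<le> K / l * (M * norm y)"
      unfolding g_def f_def using l pos by (intro R_U_bound) auto
    also have "\<dots> \<le> K * \<eta> * (M * norm y)"
      using const_pos by (intro mult_right_mono Kl) auto
    finally have "\<omega>\<^sub>0 * norm (g \<tau>) \<le> \<omega>\<^sub>0 * (K * \<eta> * (M * norm y))"
      using const_pos by (intro mult_left_mono)
    then have g: "norm (\<omega>\<^sub>0 *\<^sub>R g \<tau>) \<le> \<omega>\<^sub>0 * K * M * \<eta> * norm y"
      using const_pos by (simp add: mult_ac)
    have "norm (R l r (V (r + \<eta> * \<tau>) r y) - l *\<^sub>R g \<tau> + f \<tau>)
        = norm ((R l r (V (r + \<eta> * \<tau>) r y) - (l + \<omega>\<^sub>0) *\<^sub>R g \<tau> + f \<tau>) + \<omega>\<^sub>0 *\<^sub>R g \<tau>)"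
      by (simp add: algebra_simps)
    also have "\<dots> \<le> (K * \<eta> powr (\<mu> + \<nu> - 1) * \<tau> powr (\<mu> - 1) + \<omega>\<^sub>0 * K * M * \<eta>) * norm y"
      using norm_triangle_mono[OF E g] by (simp add: distrib_right)
    finally have *: "norm (R l r (V (r + \<eta> * \<tau>) r y) - l *\<^sub>R g \<tau> + f \<tau>)
        \<le> (K * \<eta> powr (\<mu> + \<nu> - 1) * \<tau> powr (\<mu> - 1) + \<omega>\<^sub>0 * K * M * \<eta>) * norm y" .
    have "exp (- (j * \<tau>)) * \<eta> \<le> 1 * \<eta>"
      using j pos \<eta> by (intro mult_right_mono) auto
    then show ?thesis
      unfolding norm_scaleR using \<eta> by (intro mult_mono *) auto
  qed
  have "norm (\<Psi> b - \<Psi> a) \<le> \<phi> b - \<phi> a"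
    using ab const_pos
    by (intro differentiable_bound_general[OF _ _ _ \<Psi>_deriv \<phi>_deriv bound])
       (auto simp: \<Psi>_def[abs_def] \<phi>_def[abs_def] intro!: continuous_intros g_cont I_cont)
  also have "\<dots> \<le> \<phi> b"
    unfolding \<phi>_def using const_pos ab \<eta> by auto
  finally have 1: "norm (\<Psi> b - \<Psi> a) \<le> \<phi> b" .
  have 2: "norm (exp (- (j * b)) *\<^sub>R g b) \<le> \<eta> * (exp (- b) * K * M * norm y)"
  proof -
    have "norm (g b) \<le> K / l * (M * norm y)"
      unfolding g_def f_def using l ab \<eta> by (intro R_U_bound) auto
    also have "\<dots> \<le> K * \<eta> * (M * norm y)"
      using const_pos by (intro mult_right_mono Kl) auto
    finally have "exp (- (j * b)) * norm (g b) \<le> exp (- b) * (K * \<eta> * (M * norm y))"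
      using j ab const_pos \<eta> by (intro mult_mono) auto
    then show ?thesis by (simp add: mult_ac)
  qed
  have 3: "norm (exp (- (j * a)) *\<^sub>R g a) \<le> norm (g a)"
    using j ab by (simp add: mult_left_le_one_le)
  have "\<eta> *\<^sub>R I b = (\<Psi> b - \<Psi> a) - exp (- (j * b)) *\<^sub>R g b + exp (- (j * a)) *\<^sub>R g a"
    by (simp add: \<Psi>_def I_def)
  then have "norm (\<eta> *\<^sub>R I b) \<le> norm (\<Psi> b - \<Psi> a) + norm (exp (- (j * b)) *\<^sub>R g b) + norm (exp (- (j * a)) *\<^sub>R g a)"
    using norm_triangle_ineq4[of "\<Psi> b - \<Psi> a" "exp (- (j * b)) *\<^sub>R g b"]
      norm_triangle_ineq[of "(\<Psi> b - \<Psi> a) - exp (- (j * b)) *\<^sub>R g b" "exp (- (j * a)) *\<^sub>R g a"] by simp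
  also have "\<dots> \<le> \<phi> b + \<eta> * (exp (- b) * K * M * norm y) + norm (g a)"
    by (intro add_mono 1 2 3)
  finally have "\<eta> * norm (I b) \<le> \<phi> b + \<eta> * (exp (- b) * K * M * norm y) + norm (g a)"
    using \<eta> by simp
  then have "norm (I b) \<le> (\<phi> b + \<eta> * (exp (- b) * K * M * norm y) + norm (g a)) / \<eta>"
    using \<eta> by (simp add: field_simps)
  also have "\<dots> = (K * \<eta> powr (\<mu> + \<nu> - 1) * b powr \<mu> / \<mu> + \<omega>\<^sub>0 * K * M * \<eta> * b + exp (- b) * K * M) * norm y
      + norm (g a) / \<eta>"
    using \<eta> by (simp add: \<phi>_def add_divide_distrib distrib_right)
  finally show ?thesis by (simp add: I_def f_def g_def l_def)
qed

text \<open>The increment \<open>y = x - U r (r - h) x\<close> has small resolvents: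
  \<open>resolvent_increment\<close> shows this at time \<open>r - h\<close>, and
  \<open>R_change\<close> moves it to time \<open>r\<close>. By \<open>laplace_bound\<close>
  finitely many Laplace transforms of \<open>U (r + \<eta> * \<tau>) r y\<close> are then small, and
  \<open>laplace_tauberian\<close> recovers the value at \<open>\<tau> = ln 2\<close>. The order of
  choice is \<open>N\<close> and \<delta>, \<open>b\<close>, \<eta>, \<open>h0\<close>, and finally
  \<open>a\<close>.\<close>

lemma smoothing_increment:
  assumes "0 < d" "0 < \<epsilon>"
  obtains \<eta> h0 where "0 < \<eta>" "\<eta> \<le> d" "0 < h0"
    "\<And>r h x. 0 < h \<Longrightarrow> h < h0 \<Longrightarrow> norm (U (r + \<eta> * ln 2) r (x - U r (r - h) x)) \<le> \<epsilon> * norm x"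
proof -
  \<comment> \<open>For unit \<open>x\<close> the increment \<open>y\<close> has norm at most
    \<open>1 + M\<close>; \<open>C'\<close> bounds both the size of the rescaled orbit and its
    Lipschitz constant on \<open>{1/2..1}\<close>, uniformly in \<eta>.\<close>
  define C' where "C' = (M + 2 * C) * (1 + M)"
  have C': "0 \<le> C'" using const_pos by (simp add: C'_def)
  show thesis
  proof (rule laplace_tauberian[where 'a = 'a, OF assms(2) C'])
    fix N :: nat and \<delta> :: real
    assume \<delta>: "\<delta> > 0"
      and tauberian: "\<And>(f :: real \<Rightarrow> 'a) a b. 0 < a \<Longrightarrow> a \<le> 1 / 2 \<Longrightarrow> 1 \<le> b \<Longrightarrow> continuous_on {a..b} f \<Longrightarrow>
         (\<And>x. x \<in> {a..b} \<Longrightarrow> norm (f x) \<le> C') \<Longrightarrow>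
         (\<And>x y. x \<in> {1/2..1} \<Longrightarrow> y \<in> {1/2..1} \<Longrightarrow> norm (f x - f y) \<le> C' * \<bar>x - y\<bar>) \<Longrightarrow>
         (\<And>j. j \<in> {1..N} \<Longrightarrow> norm (integral {a..b} (\<lambda>\<tau>. exp (- (real j * \<tau>)) *\<^sub>R f \<tau>)) \<le> \<delta>) \<Longrightarrow>
         norm (f (ln 2)) \<le> \<epsilon>"
    define c where "c = K * M * (1 + M)"
    \<comment> \<open>The cut-off of the Laplace integral: \<open>b \<le> exp b\<close> makes the
      tail term \<open>exp (- b) * c\<close> at most \<open>\<delta> / 4\<close>.\<close>
    define b where "b = max 1 (4 * c / \<delta>)"
    have b: "1 \<le> b" "exp (- b) * c \<le> \<delta> / 4"
    proof -
      show b1: "1 \<le> b" by (simp add: b_def)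
      have "c \<le> \<delta> / 4 * b" using \<delta> by (simp add: b_def max_def field_simps)
      also have "\<dots> \<le> \<delta> / 4 * exp b"
        using exp_ge_add_one_self[of b] \<delta> by (intro mult_left_mono) linarith+
      finally show "exp (- b) * c \<le> \<delta> / 4"
        by (simp add: exp_minus field_simps)
    qed
    \<comment> \<open>The part of the bound in \<open>laplace_bound\<close> that is small with
      \<eta> for fixed \<open>b\<close>.\<close>
    define q where "q \<eta> = (K * \<eta> powr (\<mu> + \<nu> - 1) * b powr \<mu> / \<mu> + \<omega>\<^sub>0 * K * M * \<eta> * b) * (1 + M)" for \<eta>
    have id0: "((\<lambda>x::real. x) \<longlongrightarrow> 0) (at_right 0)"
      by (rule tendsto_ident_at)
    have powr0: "((\<lambda>x. x powr e) \<longlongrightarrow> 0) (at_right (0::real))" if "0 < e" for e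
      by (rule tendsto_zero_powrI[OF id0 tendsto_const _ that]) (simp add: eventually_at_filter)
    have "(q \<longlongrightarrow> (K * 0 * b powr \<mu> / \<mu> + \<omega>\<^sub>0 * K * M * 0 * b) * (1 + M)) (at_right 0)"
      unfolding q_def using const_pos by (intro tendsto_intros powr0 id0) auto
    then have "eventually (\<lambda>\<eta>. q \<eta> < \<delta> / 4) (at_right 0)"
      using \<delta> by (intro order_tendstoD(2)) auto
    moreover have "eventually (\<lambda>\<eta>. \<eta> \<in> {0<..<min d (1 / b)}) (at_right 0)"
      using assms b by (intro eventually_at_right_real) auto
    ultimately obtain \<eta> where "q \<eta> < \<delta> / 4" and \<eta>': "\<eta> \<in> {0<..<min d (1 / b)}"
      using eventually_happens[OF eventually_conj] by (metis (mono_tags, lifting) trivial_limit_at_right_real)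
    then have q: "q \<eta> \<le> \<delta> / 4" and \<eta>: "0 < \<eta>" "\<eta> \<le> d" "\<eta> * b \<le> 1" "\<eta> \<le> 1"
    proof -
      show "q \<eta> \<le> \<delta> / 4" "0 < \<eta>" "\<eta> \<le> d" using \<open>q \<eta> < \<delta> / 4\<close> \<eta>' by auto
      show \<eta>b: "\<eta> * b \<le> 1" using \<eta>' b by (simp add: field_simps)
      show "\<eta> \<le> 1" proof -
        have "\<eta> * 1 \<le> \<eta> * b" using b \<eta>' by (intro mult_left_mono) auto
        then show ?thesis using \<eta>b by linarith
      qed
    qed
    \<comment> \<open>Bounds the resolvents of \<open>y\<close> at time \<open>r\<close>. It is
      compared with a multiple of \<open>\<delta> * \<eta>\<close>, since
      \<open>laplace_bound\<close> divides by \<eta>; hence \<open>h0\<close> is chosen after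
      \<eta>.\<close>
    define p where "p h = K * (K * h powr \<mu> / \<mu> + ((1 + \<omega>\<^sub>0) * K + 1) * M * h + h powr \<mu> * (1 + M))" for h
    have "(p \<longlongrightarrow> K * (K * 0 / \<mu> + ((1 + \<omega>\<^sub>0) * K + 1) * M * 0 + 0 * (1 + M))) (at_right 0)"
      unfolding p_def using const_pos by (intro tendsto_intros powr0 id0) auto
    then have "eventually (\<lambda>h. p h < \<delta> * \<eta> / 4) (at_right 0)"
      using \<delta> \<eta> by (intro order_tendstoD(2)) auto
    then obtain h1 where h1: "0 < h1" "\<And>h. 0 < h \<Longrightarrow> h < h1 \<Longrightarrow> p h < \<delta> * \<eta> / 4"
      by (auto simp: eventually_at_right_field)
    define h0 where "h0 = min 1 h1"
    have unit: "norm (U (r + \<eta> * ln 2) r (x - U r (r - h) x)) \<le> \<epsilon>"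
      if h: "0 < h" "h < h0" and x: "norm x = 1" for r h x
    proof -
      define y where "y = x - U r (r - h) x"
      have y: "norm y \<le> 1 + M"
        using norm_triangle_ineq4[of x "U r (r - h) x"] U_apply_bound[of "r - h" r x] h x
        by (simp add: y_def)
      have Ry: "norm (R l r y) \<le> \<delta> * \<eta> / 4" if "0 < l" for l
      proof -
        have "R 1 (r - h) y = - (R 1 (r - h) (U (r - h + h) (r - h) x - x))"
          by (simp add: y_def blinfun.diff_right)
        then have "norm (R 1 (r - h) y) \<le> K * h powr \<mu> / \<mu> + ((1 + \<omega>\<^sub>0) * K + 1) * M * h"
          using resolvent_increment[of h "r - h" x] h x by (simp add: h0_def)
        then have "K * (norm (R 1 (r - h) y) + \<bar>r - (r - h)\<bar> powr \<mu> * norm y) \<le> p h"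
          unfolding p_def using const_pos h y by (intro mult_left_mono add_mono) auto
        then have "norm (R l r y) \<le> p h"
          using R_change[OF that, of r y "r - h"] by linarith
        then show ?thesis using h1(2)[of h] h by (simp add: h0_def)
      qed
      define f where "f \<tau> = U (r + \<eta> * \<tau>) r y" for \<tau>
      have shift: "filterlim (\<lambda>a. r + \<eta> * a) (at_right r) (at_right 0)"
      proof -
        have "((\<lambda>a. r + \<eta> * a) \<longlongrightarrow> r + \<eta> * 0) (at_right 0)"
          by (intro tendsto_intros id0)
        moreover have "eventually (\<lambda>a. r + \<eta> * a \<in> {r<..}) (at_right 0)"
          using \<eta> by (auto simp: eventually_at_right_field intro!: exI[of _ 1])
        ultimately show ?thesis using \<eta>
            by (auto simp: filterlim_at elim!: eventually_mono)
      qed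
      \<comment> \<open>The starting point \<open>a\<close> may depend on \<open>r\<close>,
        \<open>h\<close> and \<open>x\<close>, because \<delta> and \<open>N\<close> are uniform in
        \<open>a\<close>. It is taken so close to 0 that the resolvents of \<open>f a\<close> are
        nearly those of \<open>y\<close>.\<close>
      have "eventually (\<lambda>a. norm (R (real j / \<eta>) r (f a)) < \<delta> * \<eta> / 2) (at_right 0)" if "j \<in> {1..N}" for j
      proof -
        have j: "0 < real j / \<eta>" using that \<eta> by auto
        have "((\<lambda>a. norm (R (real j / \<eta>) r (f a))) \<longlongrightarrow> norm (R (real j / \<eta>) r y)) (at_right 0)"
          unfolding f_def by (intro tendsto_norm filterlim_compose[OF R_lim[OF j] shift])
        moreover have "norm (R (real j / \<eta>) r y) < \<delta> * \<eta> / 2"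
          using Ry[OF j] mult_pos_pos[OF \<delta> \<eta>(1)] by linarith
        ultimately show ?thesis by (rule order_tendstoD(2))
      qed
      then have "eventually (\<lambda>a. \<forall>j\<in>{1..N}. norm (R (real j / \<eta>) r (f a)) < \<delta> * \<eta> / 2) (at_right 0)"
        by (intro eventually_ball_finite) auto
      moreover have "eventually (\<lambda>a. a \<in> {0<..<1 / 2 :: real}) (at_right 0)"
        by (rule eventually_at_right_real) simp
      ultimately obtain a where aj: "\<forall>j\<in>{1..N}. norm (R (real j / \<eta>) r (f a)) < \<delta> * \<eta> / 2"
        and a: "a \<in> {0<..<1 / 2 :: real}"
        using eventually_happens[OF eventually_conj] by (metis (mono_tags, lifting) trivial_limit_at_right_real)
      have "norm (f (ln 2)) \<le> \<epsilon>"
      proof (rule tauberian[of a b])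
        show "0 < a" "a \<le> 1 / 2" "1 \<le> b" using a b by auto
        show "continuous_on {a..b} f"
          unfolding f_def using a \<eta>
          by (intro continuous_on_compose2[OF U_apply_cont] continuous_intros) auto
        show "norm (f \<tau>) \<le> C'" if "\<tau> \<in> {a..b}" for \<tau>
        proof -
          have "norm (f \<tau>) \<le> M * norm y"
            unfolding f_def using that a \<eta> by (intro U_apply_bound) auto
          also have "\<dots> \<le> (M + 2 * C) * (1 + M)"
            using y const_pos by (intro mult_mono) auto
          finally show ?thesis by (simp add: C'_def)
        qed
        have lip: "norm (f \<tau>' - f \<tau>) \<le> C' * (\<tau>' - \<tau>)" if "1 / 2 \<le> \<tau>" "\<tau> \<le> \<tau>'" "\<tau>' \<le> 1" for \<tau> \<tau>'
        proof -
          have "\<eta> * \<tau>' \<le> 1" using mult_mono[of \<eta> 1 \<tau>' 1] \<eta> that by auto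
          moreover have "\<eta> / 2 \<le> \<eta> * \<tau>" "\<eta> * \<tau> \<le> \<eta> * \<tau>'"
            using \<eta> that mult_left_mono[of "1 / 2" \<tau> \<eta>] by auto
          ultimately have "norm (U (r + \<eta> * \<tau>') r - U (r + \<eta> * \<tau>) r)
              \<le> C / (\<eta> / 2) * ((r + \<eta> * \<tau>') - (r + \<eta> * \<tau>))"
            using \<eta> by (intro U_lipschitz) auto
          also have "\<dots> = 2 * C * (\<tau>' - \<tau>)"
            using \<eta> by (simp add: field_simps)
          finally have *: "norm (U (r + \<eta> * \<tau>') r - U (r + \<eta> * \<tau>) r) \<le> 2 * C * (\<tau>' - \<tau>)" .
          have "norm (f \<tau>' - f \<tau>) = norm ((U (r + \<eta> * \<tau>') r - U (r + \<eta> * \<tau>) r) y)"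
            by (simp add: f_def blinfun.diff_left)
          also have "\<dots> \<le> 2 * C * (\<tau>' - \<tau>) * norm y"
            by (rule order_trans[OF norm_blinfun mult_right_mono[OF *]]) simp
          also have "\<dots> \<le> (M + 2 * C) * (\<tau>' - \<tau>) * (1 + M)"
            using y const_pos that by (intro mult_mono) auto
          finally show ?thesis by (simp add: C'_def mult_ac)
        qed
        show "norm (f \<tau> - f \<tau>') \<le> C' * \<bar>\<tau> - \<tau>'\<bar>" if "\<tau> \<in> {1/2..1}" "\<tau>' \<in> {1/2..1}" for \<tau> \<tau>'
          using lip[of \<tau> \<tau>'] lip[of \<tau>' \<tau>] that by (cases "\<tau> \<le> \<tau>'") (auto simp: norm_minus_commute)
        show "norm (integral {a..b} (\<lambda>\<tau>. exp (- (real j * \<tau>)) *\<^sub>R f \<tau>)) \<le> \<delta>" if "j \<in> {1..N}" for j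
        proof -
          have "norm (integral {a..b} (\<lambda>\<tau>. exp (- (real j * \<tau>)) *\<^sub>R f \<tau>))
            \<le> (K * \<eta> powr (\<mu> + \<nu> - 1) * b powr \<mu> / \<mu> + \<omega>\<^sub>0 * K * M * \<eta> * b + exp (- b) * K * M) * norm y
              + norm (R (real j / \<eta>) r (f a)) / \<eta>"
            unfolding f_def using that \<eta> a b by (intro laplace_bound) auto
          also have "\<dots> \<le> (K * \<eta> powr (\<mu> + \<nu> - 1) * b powr \<mu> / \<mu> + \<omega>\<^sub>0 * K * M * \<eta> * b + exp (- b) * K * M) * (1 + M)
              + (\<delta> * \<eta> / 2) / \<eta>"
            using y const_pos \<eta> b less_imp_le[OF aj[rule_format, OF that]]
            by (intro add_mono mult_left_mono divide_right_mono) auto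
          \<comment> \<open>The three terms are at most \<open>\<delta> / 4\<close>,
            \<open>\<delta> / 4\<close> and \<open>\<delta> / 2\<close>.\<close>
          also have "\<dots> = q \<eta> + exp (- b) * c + \<delta> / 2"
            using \<eta> by (simp add: q_def c_def algebra_simps)
          also have "\<dots> \<le> \<delta>" using q b by simp
          finally show ?thesis .
        qed
      qed
      then show ?thesis by (simp add: f_def y_def)
    qed
    show thesis
    proof (rule that[of \<eta> h0])
      fix r h x assume h: "0 < h" "h < h0"
      show "norm (U (r + \<eta> * ln 2) r (x - U r (r - h) x)) \<le> \<epsilon> * norm x"
      proof (cases "x = 0")
        case False
        define e where "e = sgn x"
        have x: "x = norm x *\<^sub>R e" and e: "norm e = 1"
          using False by (auto simp: e_def sgn_div_norm)
        have "U (r + \<eta> * ln 2) r (x - U r (r - h) x) = norm x *\<^sub>R U (r + \<eta> * ln 2) r (e - U r (r - h) e)"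
          by (subst (1 2) x) (simp add: blinfun.scaleR_right flip: scaleR_right_diff_distrib)
        then show ?thesis
          using mult_left_mono[OF unit[OF h e], of "norm x"] by (simp add: mult.commute)
      qed (simp add: blinfun.zero_right)
    qed (use \<eta> h1 in \<open>auto simp: h0_def\<close>)
  qed
qed

section \<open>Uniform increments in each time variable\<close>

text \<open>With \<open>m = r + \<eta> * ln 2\<close>, the difference factors as
  \<open>U p m\<close> after \<open>U m r\<close> applied to \<open>x - U r (r - h) x\<close>. The
  inner part is small by \<open>smoothing_increment\<close>, and the outer part supplies the
  decay.\<close>

lemma right_increment:
  assumes "0 < d" "0 < \<epsilon>"
  obtains h0 where "0 < h0"
    "\<And>p r h. r + d \<le> p \<Longrightarrow> 0 \<le> h \<Longrightarrow> h < h0 \<Longrightarrow> norm (U p r - U p (r - h)) \<le> \<epsilon> * exp (- \<omega> * (p - r))"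
proof -
  \<comment> \<open>The factor \<open>exp (\<omega> * d)\<close> pays for the decay lost between
    \<open>r\<close> and \<open>m\<close>.\<close>
  define \<epsilon>' where "\<epsilon>' = \<epsilon> / (M * exp (\<omega> * d))"
  have "0 < \<epsilon>'" using assms const_pos by (simp add: \<epsilon>'_def)
  with assms obtain \<eta> h0 where \<eta>: "0 < \<eta>" "\<eta> \<le> d" and h0: "0 < h0"
    and inc: "\<And>r h x. 0 < h \<Longrightarrow> h < h0 \<Longrightarrow> norm (U (r + \<eta> * ln 2) r (x - U r (r - h) x)) \<le> \<epsilon>' * norm x"
    using smoothing_increment by metis
  show thesis
  proof (rule that[OF h0])
    fix p r h assume p: "r + d \<le> p" and h: "0 \<le> h" "h < h0"
    show "norm (U p r - U p (r - h)) \<le> \<epsilon> * exp (- \<omega> * (p - r))"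
    proof (cases "h = 0")
      case False
      define m where "m = r + \<eta> * ln 2"
      have "\<eta> * ln 2 \<le> \<eta>" using mult_left_mono[of "ln 2" 1 \<eta>] \<eta> ln_2_less_1 by simp
      then have "\<eta> * ln 2 \<le> d" using \<eta> by linarith
      then have m: "r \<le> m" "m \<le> r + d" "m \<le> p" using \<eta> p mult_nonneg_nonneg[of \<eta> "ln 2"] unfolding m_def by auto
      show ?thesis
      proof (rule norm_blinfun_bound)
        fix x
        have "(U p r - U p (r - h)) x = U p m (U m r (x - U r (r - h) x))"
          using U_comp[of r m p] U_comp[of "r - h" r p] h m
          by (simp add: blinfun.diff_left blinfun.diff_right)
        then have "norm ((U p r - U p (r - h)) x) \<le> norm (U p m) * norm (U m r (x - U r (r - h) x))"
          by (simp add: norm_blinfun)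
        also have "\<dots> \<le> (M * exp (- \<omega> * (p - m))) * (\<epsilon>' * norm x)"
          using h False m const_pos inc[of h r x]
          by (intro mult_mono U_bound) (auto simp: m_def)
        also have "\<dots> \<le> (M * exp (- \<omega> * (p - (r + d)))) * (\<epsilon>' * norm x)"
          using m const_pos \<open>0 < \<epsilon>'\<close> by (intro mult_right_mono mult_left_mono) auto
        also have "\<dots> = \<epsilon> * exp (- \<omega> * (p - r)) * norm x"
        proof -
          have "exp (- \<omega> * (p - (r + d))) = exp (- \<omega> * (p - r)) * exp (\<omega> * d)"
            by (simp add: algebra_simps flip: exp_add)
          then show ?thesis using const_pos by (simp add: \<epsilon>'_def)
        qed
        finally show "norm ((U p r - U p (r - h)) x) \<le> \<epsilon> * exp (- \<omega> * (p - r)) * norm x" .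
      qed (use assms in auto)
    qed (use assms in auto)
  qed
qed

text \<open>Both operators are factored through time \<open>p - e\<close>. The increment of the
  outer factors is Lipschitz in \<open>h\<close>, and the common inner factor
  \<open>U (p - e) r\<close> supplies the decay.\<close>

lemma left_increment:
  assumes "0 < d" "0 < \<epsilon>"
  obtains h0 where "0 < h0"
    "\<And>p r h. r + d \<le> p \<Longrightarrow> 0 \<le> h \<Longrightarrow> h < h0 \<Longrightarrow> norm (U (p + h) r - U p r) \<le> \<epsilon> * exp (- \<omega> * (p - r))"
proof -
  \<comment> \<open>With \<open>e\<close> and \<open>h0\<close> at most \<open>1 / 2\<close>, the
    time \<open>p + h\<close> stays within distance 1 of \<open>p - e\<close>, where the derivative
    bound holds.\<close>
  define e where "e = min d (1 / 2)"
  have e: "0 < e" "e \<le> d" "e \<le> 1 / 2" using assms by (auto simp: e_def)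
  define c where "c = C / e * (M * exp (\<omega> * e))"
  have c: "0 \<le> c" using const_pos e by (simp add: c_def)
  define h0 where "h0 = min (1 / 2) (\<epsilon> / (c + 1))"
  show thesis
  proof (rule that)
    show "0 < h0" using assms c by (simp add: h0_def)
    fix p r h assume p: "r + d \<le> p" and h: "0 \<le> h" "h < h0"
    have "norm (U (p + h) (p - e) - U p (p - e)) \<le> C / e * (p + h - p)"
      using e h by (intro U_lipschitz) (auto simp: h0_def)
    then have 1: "norm (U (p + h) (p - e) - U p (p - e)) \<le> C / e * h" by simp
    have "U (p + h) r - U p r = (U (p + h) (p - e) - U p (p - e)) o\<^sub>L U (p - e) r"
      using U_comp[of r "p - e" "p + h"] U_comp[of r "p - e" p] e p h
      by (intro blinfun_eqI) (simp add: blinfun.diff_left)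
    then have "norm (U (p + h) r - U p r) \<le> norm (U (p + h) (p - e) - U p (p - e)) * norm (U (p - e) r)"
      by (simp add: norm_blinfun_compose)
    also have "\<dots> \<le> (C / e * h) * (M * exp (- \<omega> * (p - e - r)))"
      using e p h const_pos by (intro mult_mono 1 U_bound) auto
    also have "\<dots> = c * h * exp (- \<omega> * (p - r))"
    proof -
      have "exp (- \<omega> * (p - e - r)) = exp (- \<omega> * (p - r)) * exp (\<omega> * e)"
        by (simp add: algebra_simps flip: exp_add)
      then show ?thesis by (simp add: c_def)
    qed
    also have "\<dots> \<le> \<epsilon> * exp (- \<omega> * (p - r))"
    proof (intro mult_right_mono)
      have "c * h \<le> (c + 1) * (\<epsilon> / (c + 1))"
        using c h by (intro mult_mono) (auto simp: h0_def)
      then show "c * h \<le> \<epsilon>" using c by simp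
    qed simp
    finally show "norm (U (p + h) r - U p r) \<le> \<epsilon> * exp (- \<omega> * (p - r))" .
  qed
qed

text \<open>Moves one variable at a time: \<open>right_increment\<close> at the shifted pair
  \<open>p + h\<close>, \<open>r + h\<close>, whose distance is still \<open>p - r\<close>, followed
  by \<open>left_increment\<close>.\<close>

lemma joint_increment:
  assumes "0 < d" "0 < \<epsilon>"
  obtains h0 where "0 < h0"
    "\<And>p r h. r + d \<le> p \<Longrightarrow> 0 \<le> h \<Longrightarrow> h < h0 \<Longrightarrow>
      norm (U (p + h) (r + h) - U p r) \<le> \<epsilon> * exp (- \<omega> * (p - r))"
proof -
  obtain h1 where h1: "0 < h1" "\<And>p r h. r + d \<le> p \<Longrightarrow> 0 \<le> h \<Longrightarrow> h < h1 \<Longrightarrow>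
      norm (U p r - U p (r - h)) \<le> \<epsilon> / 2 * exp (- \<omega> * (p - r))"
    using right_increment[of d "\<epsilon> / 2"] assms by (metis half_gt_zero)
  obtain h2 where h2: "0 < h2" "\<And>p r h. r + d \<le> p \<Longrightarrow> 0 \<le> h \<Longrightarrow> h < h2 \<Longrightarrow>
      norm (U (p + h) r - U p r) \<le> \<epsilon> / 2 * exp (- \<omega> * (p - r))"
    using left_increment[of d "\<epsilon> / 2"] assms by (metis half_gt_zero)
  show thesis
  proof (rule that[of "min h1 h2"])
    fix p r h assume "r + d \<le> p" "0 \<le> h" "h < min h1 h2"
    then have "norm (U (p + h) (r + h) - U (p + h) r) \<le> \<epsilon> / 2 * exp (- \<omega> * (p - r))"
      "norm (U (p + h) r - U p r) \<le> \<epsilon> / 2 * exp (- \<omega> * (p - r))"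
      using h1(2)[of "r + h" "p + h" h] h2(2)[of r p h] by auto
    from norm_triangle_mono[OF this]
    show "norm (U (p + h) (r + h) - U p r) \<le> \<epsilon> * exp (- \<omega> * (p - r))"
      by simp
  qed (use h1 h2 in auto)
qed

text \<open>Continuity in operator norm, stronger than the strong continuity of an evolution system;
  the measurability of \<open>G_dist\<close> rests on it.\<close>

lemma U_right_cont: "continuous_on {..<t} (U t)"
proof (intro continuous_at_imp_continuous_on ballI)
  fix s assume s: "s \<in> {..<t}"
  define d where "d = (t - s) / 2"
  have d: "0 < d" "s + d < t" using s by (auto simp: d_def field_simps)
  show "isCont (U t) s"
  proof (rule continuous_at_eps_delta[THEN iffD2], intro allI impI)
    fix \<epsilon> :: real assume "0 < \<epsilon>"
    then obtain h0 where h0: "0 < h0" "\<And>p r h. r + d \<le> p \<Longrightarrow> 0 \<le> h \<Longrightarrow> h < h0 \<Longrightarrow>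
        norm (U p r - U p (r - h)) \<le> \<epsilon> / 2 * exp (- \<omega> * (p - r))"
      using right_increment[of d "\<epsilon> / 2"] d by (metis half_gt_zero)
    have small: "norm (U t r - U t (r - h)) < \<epsilon>" if "r + d \<le> t" "0 \<le> h" "h < h0" for r h
    proof -
      have "\<epsilon> / 2 * exp (- \<omega> * (t - r)) \<le> \<epsilon> / 2 * 1"
        using that d const_pos \<open>0 < \<epsilon>\<close> by (intro mult_left_mono) auto
      then show ?thesis using h0(2)[OF that] \<open>0 < \<epsilon>\<close> by linarith
    qed
    show "\<exists>\<delta>>0. \<forall>r. dist r s < \<delta> \<longrightarrow> dist (U t r) (U t s) < \<epsilon>"
    \<comment> \<open>The second radius keeps \<open>r + d \<le> t\<close> for the \<open>r\<close>
      to the right of \<open>s\<close>, where the increment ends at \<open>r\<close> instead of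
      \<open>s\<close>.\<close>
    proof (intro exI[of _ "min h0 (t - s - d)"] conjI allI impI)
      fix r assume r: "dist r s < min h0 (t - s - d)"
      show "dist (U t r) (U t s) < \<epsilon>"
      proof (cases "s \<le> r")
        case True
        then show ?thesis using small[of r "r - s"] r by (auto simp: dist_norm)
      next
        case False
        then show ?thesis using small[of s "s - r"] r d by (auto simp: dist_norm norm_minus_commute)
      qed
    qed (use h0 d in auto)
  qed
qed

subsection \<open>Convolution with the Green kernel\<close>

text \<open>The Green's function for identity projections, in a form free of inverses;
  \<open>green_exponentially_stable\<close> identifies the two.\<close>

definition G :: "real \<Rightarrow> real \<Rightarrow> ('a \<Rightarrow>\<^sub>L 'a)" where
  "G t s = (if s \<le> t then U t s else 0)"

definition G_dist :: "real \<Rightarrow> real \<Rightarrow> real \<Rightarrow> real" where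
  "G_dist t t' s = norm (G t (t - s) - G t' (t' - s))"

lemma G_dist_nonneg [simp]: "0 \<le> G_dist t t' s"
  by (simp add: G_dist_def)

lemma G_bound: "norm (G t (t - s)) \<le> M * exp_kernel \<omega> s"
  using U_bound[of "t - s" t] by (auto simp: G_def exp_kernel_def)

lemma G_bound_const: "norm (G t s) \<le> M"
  using U_bound_const[of s t] const_pos by (auto simp: G_def)

lemma G_cont: "continuous_on {0<..} (\<lambda>s. G t (t - s))"
proof -
  have "continuous_on {0<..} (\<lambda>s. U t (t - s))"
    by (intro continuous_on_compose2[OF U_right_cont] continuous_intros) auto
  then show ?thesis by (rule continuous_on_eq) (auto simp: G_def)
qed

text \<open>The function is continuous on the positive half-line and zero on the negative one; the
  single point 0, where continuity may fail, is added by an indicator.\<close>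

lemma borel_measurable_G_dist [measurable]: "G_dist t t' \<in> borel_measurable borel"
proof -
  have "(\<lambda>s. indicator {0<..} s *\<^sub>R G_dist t t' s) \<in> borel_measurable borel"
    unfolding G_dist_def
    by (intro borel_measurable_continuous_on_indicator continuous_intros G_cont) auto
  moreover have "(\<lambda>s::real. indicator {0} s * G_dist t t' 0) \<in> borel_measurable borel"
    by (intro borel_measurable_times borel_measurable_indicator borel_measurable_const)
      auto
  ultimately have "(\<lambda>s. indicator {0<..} s *\<^sub>R G_dist t t' s + indicator {0} s * G_dist t t' 0)
      \<in> borel_measurable borel"
    by measurable
  moreover have "(\<lambda>s. indicator {0<..} s *\<^sub>R G_dist t t' s + indicator {0} s * G_dist t t' 0) = G_dist t t'"
    by (auto simp: fun_eq_iff G_dist_def G_def indicator_def)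
  ultimately show ?thesis by simp
qed

lemma nn_integral_G_dist_commute:
  "(\<integral>\<^sup>+ s. ennreal (G_dist t t' s) \<partial>lborel) = (\<integral>\<^sup>+ s. ennreal (G_dist t' t s) \<partial>lborel)"
  by (simp add: G_dist_def norm_minus_commute)

lemma nn_integral_G_dist_triangle:
  "(\<integral>\<^sup>+ s. ennreal (G_dist t t'' s) \<partial>lborel)
    \<le> (\<integral>\<^sup>+ s. ennreal (G_dist t t' s) \<partial>lborel) + (\<integral>\<^sup>+ s. ennreal (G_dist t' t'' s) \<partial>lborel)"
proof -
  have "G_dist t t'' s \<le> G_dist t t' s + G_dist t' t'' s" for s
    unfolding G_dist_def using norm_triangle_ineq[of "G t (t - s) - G t' (t' - s)" "G t' (t' - s) - G t'' (t'' - s)"]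
    by simp
  then have "(\<integral>\<^sup>+ s. ennreal (G_dist t t'' s) \<partial>lborel)
      \<le> (\<integral>\<^sup>+ s. ennreal (G_dist t t' s) + ennreal (G_dist t' t'' s) \<partial>lborel)"
    by (intro nn_integral_mono) (simp add: ennreal_leI flip: ennreal_plus)
  also have "\<dots> = (\<integral>\<^sup>+ s. ennreal (G_dist t t' s) \<partial>lborel) + (\<integral>\<^sup>+ s. ennreal (G_dist t' t'' s) \<partial>lborel)"
    by (intro nn_integral_add) auto
  finally show ?thesis .
qed

text \<open>Below distance \<open>d\<close> from the diagonal the crude bound \<open>2 * M\<close>
  costs \<open>2 * M * d = \<epsilon> / 2\<close>; beyond it \<open>joint_increment\<close> costs
  \<open>e / \<omega> = \<epsilon> / 2\<close>. Negative \<open>h\<close> reduces to positive by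
  exchanging the two times.\<close>

lemma nn_integral_G_dist_small:
  assumes "0 < \<epsilon>"
  shows "\<exists>\<delta>>0. \<forall>h. \<bar>h\<bar> < \<delta> \<longrightarrow> (\<forall>t. (\<integral>\<^sup>+ s. ennreal (G_dist (t + h) t s) \<partial>lborel) \<le> ennreal \<epsilon>)"
proof -
  define d where "d = \<epsilon> / (4 * M)"
  define e where "e = \<epsilon> * \<omega> / 2"
  have d: "0 < d" "0 < e" using assms const_pos by (auto simp: d_def e_def)
  then obtain \<delta> where \<delta>: "0 < \<delta>" "\<And>p r h. r + d \<le> p \<Longrightarrow> 0 \<le> h \<Longrightarrow> h < \<delta> \<Longrightarrow>
      norm (U (p + h) (r + h) - U p r) \<le> e * exp (- \<omega> * (p - r))"
    using joint_increment by metis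
  have pos: "(\<integral>\<^sup>+ s. ennreal (G_dist (t + h) t s) \<partial>lborel) \<le> ennreal \<epsilon>" if h: "0 \<le> h" "h < \<delta>" for h t
  proof -
    define b where "b s = 2 * M * indicat_real {0..d} s + e * exp_kernel \<omega> s" for s
    have le: "G_dist (t + h) t s \<le> b s" for s
    proof (cases "s < d")
      case True
      have "G_dist (t + h) t s \<le> 2 * M"
        unfolding G_dist_def
        using norm_triangle_ineq4[of "G (t + h) (t + h - s)" "G t (t - s)"]
          G_bound_const[of "t + h" "t + h - s"] G_bound_const[of t "t - s"] by linarith
      then show ?thesis
        using True d by (cases "s < 0") (auto simp: b_def G_dist_def G_def indicator_def intro: add_increasing2)
    next
      case False
      then have "G_dist (t + h) t s \<le> e * exp_kernel \<omega> s"
        using \<delta>(2)[of "t - s" t h] h d by (simp add: G_dist_def G_def exp_kernel_def algebra_simps)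
      then show ?thesis using const_pos by (auto simp: b_def indicator_def)
    qed
    have "(b has_integral (2 * M * (d - 0) + e * (1 / \<omega>))) UNIV"
      unfolding b_def using d const_pos
      by (intro has_integral_add has_integral_mult_right has_integral_indicator_Icc has_integral_exp_kernel) auto
    moreover have "2 * M * (d - 0) + e * (1 / \<omega>) = \<epsilon>"
      using const_pos by (simp add: d_def e_def field_simps)
    ultimately have "(b has_integral \<epsilon>) UNIV" by simp
    then have "(\<integral>\<^sup>+ s. ennreal (b s) \<partial>lborel) = ennreal \<epsilon>"
      using d const_pos by (intro nn_integral_has_integral_lborel) (auto simp: b_def[abs_def])
    moreover have "(\<integral>\<^sup>+ s. ennreal (G_dist (t + h) t s) \<partial>lborel) \<le> (\<integral>\<^sup>+ s. ennreal (b s) \<partial>lborel)"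
      by (intro nn_integral_mono ennreal_leI le)
    ultimately show ?thesis by simp
  qed
  have "(\<integral>\<^sup>+ s. ennreal (G_dist (t + h) t s) \<partial>lborel) \<le> ennreal \<epsilon>" if "\<bar>h\<bar> < \<delta>" for h t
  proof (cases "0 \<le> h")
    case True
    then show ?thesis using pos that by auto
  next
    case False
    then show ?thesis using pos[of "- h" "t + h"] that by (simp add: nn_integral_G_dist_commute)
  qed
  then show ?thesis using \<delta>(1) by blast
qed

section \<open>The convolution operator on bounded continuous functions\<close>

definition conv :: "(real \<Rightarrow> 'a) \<Rightarrow> real \<Rightarrow> 'a" where
  "conv f t = integral UNIV (\<lambda>s. G t (t - s) (f (t - s)))"

text \<open>The integrand vanishes for negative \<open>s\<close> and is bounded and continuous for
  positive \<open>s\<close>, hence integrable on compact intervals despite a possible jump at 0; the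
  exponential kernel dominates it at infinity.\<close>

lemma conv_integrable:
  assumes f: "continuous_on UNIV f" "\<And>s. norm (f s) \<le> B"
  shows "(\<lambda>s. G t (t - s) (f (t - s))) integrable_on UNIV"
proof (rule integrable_on_UNIV_dominated)
  have B: "0 \<le> B" using f(2)[of 0] norm_ge_zero[of "f 0"] by linarith
  have le: "norm (G t (t - s) (f (t - s))) \<le> M * exp_kernel \<omega> s * B" for s
    by (rule order_trans[OF norm_blinfun]) (use const_pos in \<open>auto intro!: mult_mono G_bound f\<close>)
  then show "\<And>s. norm (G t (t - s) (f (t - s))) \<le> M * exp_kernel \<omega> s * B" .
  show "(\<lambda>s. M * exp_kernel \<omega> s * B) integrable_on UNIV"
    using has_integral_exp_kernel[of \<omega>] const_pos
    by (intro integrable_on_mult_left integrable_on_mult_right) auto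
  have cont: "continuous_on {0<..} (\<lambda>s. G t (t - s) (f (t - s)))"
    by (intro blinfun.continuous_on G_cont continuous_on_compose2[OF f(1)] continuous_intros) auto
  fix a b :: real
  define c where "c = max b 0"
  have "(\<lambda>s. G t (t - s) (f (t - s))) integrable_on {0..c}"
  proof (rule integrable_on_Icc_bounded_continuous_Ioc)
    show "norm (G t (t - s) (f (t - s))) \<le> M * B" if "0 < s" for s
      by (rule order_trans[OF norm_blinfun]) (use const_pos in \<open>auto intro!: mult_mono G_bound_const f\<close>)
  qed (auto intro: continuous_on_subset[OF cont])
  moreover have "(\<lambda>s. G t (t - s) (f (t - s))) integrable_on {min a 0..0}"
    by (rule integrable_spike_finite[where S = "{0}" and f = "\<lambda>_. 0"]) (auto simp: G_def)
  ultimately have "(\<lambda>s. G t (t - s) (f (t - s))) integrable_on {min a 0..c}"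
    by (intro Henstock_Kurzweil_Integration.integrable_combine[of "min a 0" 0 c]) (auto simp: c_def)
  then show "(\<lambda>s. G t (t - s) (f (t - s))) integrable_on {a..b}"
    by (rule integrable_subinterval_real) (auto simp: c_def)
qed

text \<open>Reflecting \<open>s\<close> to \<open>t - s\<close> leads back to the form of the
  integral in \<open>mild_solution\<close>.\<close>

lemma conv_has_integral:
  assumes f: "continuous_on UNIV f" "\<And>s. norm (f s) \<le> B"
  shows "((\<lambda>s. G t s (f s)) has_integral conv f t) UNIV"
  using has_integral_UNIV_reflect[OF integrable_integral[OF conv_integrable[OF f, of t]], of t]
  by (simp add: conv_def)

lemma conv_bound:
  assumes f: "continuous_on UNIV f" "\<And>s. norm (f s) \<le> B"
  shows "norm (conv f t) \<le> M * B / \<omega>"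
proof -
  have le: "norm (G t (t - s) (f (t - s))) \<le> M * exp_kernel \<omega> s * B" for s
    by (rule order_trans[OF norm_blinfun]) (use const_pos in \<open>auto intro!: mult_mono G_bound f\<close>)
  have int: "((\<lambda>s. M * exp_kernel \<omega> s * B) has_integral M * (1 / \<omega>) * B) UNIV"
    using const_pos by (intro has_integral_mult_left has_integral_mult_right has_integral_exp_kernel) auto
  have "norm (conv f t) \<le> integral UNIV (\<lambda>s. M * exp_kernel \<omega> s * B)"
    unfolding conv_def using int
    by (intro integral_norm_bound_integral conv_integrable[OF f] le) auto
  also have "\<dots> = M * B / \<omega>" using integral_unique[OF int] by simp
  finally show ?thesis .
qed

lemma conv_diff:
  assumes f: "continuous_on UNIV f" "\<And>s. norm (f s) \<le> B"
    and g: "continuous_on UNIV g" "\<And>s. norm (g s) \<le> B'"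
  shows "conv f t - conv g t = conv (\<lambda>s. f s - g s) t"
  unfolding conv_def blinfun.diff_right
  by (rule integral_diff[symmetric]) (intro conv_integrable[OF f] conv_integrable[OF g])+

text \<open>The integration variable is the absolute time \<open>s\<close>, so that only the kernel
  moves with \<open>t\<close>. Its increment is at most \<open>2 * M\<close> on
  \<open>{t - d..t + h}\<close>, an interval of length below \<open>2 * d\<close>, and small outside
  by \<open>left_increment\<close>.\<close>

lemma conv_cont:
  assumes f: "continuous_on UNIV f" "\<And>s. norm (f s) \<le> B"
  shows "continuous_on UNIV (conv f)"
proof -
  have B: "0 \<le> B" using f(2)[of 0] norm_ge_zero[of "f 0"] by linarith
  have "\<exists>\<delta>>0. \<forall>t h. 0 \<le> h \<and> h < \<delta> \<longrightarrow> norm (conv f (t + h) - conv f t) < \<epsilon>" if "0 < \<epsilon>" for \<epsilon>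
  proof -
    \<comment> \<open>A strictly positive bound, so that dividing by it is safe when
      \<open>B = 0\<close>.\<close>
    define k where "k = B + 1"
    define d where "d = \<epsilon> / (8 * M * k)"
    define e where "e = \<epsilon> * \<omega> / (4 * k)"
    have k: "0 < k" "B \<le> k" using B by (auto simp: k_def)
    have d: "0 < d" "0 < e" using that k const_pos by (auto simp: d_def e_def)
    then obtain h0 where h0: "0 < h0" "\<And>p r h. r + d \<le> p \<Longrightarrow> 0 \<le> h \<Longrightarrow> h < h0 \<Longrightarrow>
        norm (U (p + h) r - U p r) \<le> e * exp (- \<omega> * (p - r))"
      using left_increment by metis
    have "norm (conv f (t + h) - conv f t) < \<epsilon>" if h: "0 \<le> h" "h < min h0 d" for t h
    proof -
      define b where "b s = (2 * M * indicat_real {t - d..t + h} s + e * exp_kernel \<omega> (t - s)) * B" for s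
      have le: "norm (G (t + h) s (f s) - G t s (f s)) \<le> b s" for s
      proof -
        have "norm (G (t + h) s - G t s) \<le> 2 * M * indicat_real {t - d..t + h} s + e * exp_kernel \<omega> (t - s)"
        proof (cases "s \<in> {t - d..t + h}")
          case True
          have "norm (G (t + h) s - G t s) \<le> 2 * M"
            using norm_triangle_ineq4[of "G (t + h) s" "G t s"]
              G_bound_const[of "t + h" s] G_bound_const[of t s] by linarith
          then show ?thesis using True d by (auto intro: add_increasing2)
        next
          case False
          then show ?thesis
            using h0(2)[of s t h] h d by (auto simp: G_def exp_kernel_def)
        qed
        then have "norm ((G (t + h) s - G t s) (f s)) \<le> b s"
          unfolding b_def using B d const_pos
            by (intro order_trans[OF norm_blinfun] mult_mono f) auto
        then show ?thesis by (simp add: blinfun.diff_left)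
      qed
      have "(b has_integral (2 * M * (t + h - (t - d)) + e * (1 / \<omega>)) * B) UNIV"
        unfolding b_def using d h const_pos
        by (intro has_integral_add has_integral_mult_left has_integral_mult_right
            has_integral_indicator_Icc has_integral_UNIV_reflect has_integral_exp_kernel) auto
      from has_integral_norm_bound_integral_component[OF
          has_integral_diff[OF conv_has_integral[OF f, of "t + h"] conv_has_integral[OF f, of t]] this, of 1] le
      have "norm (conv f (t + h) - conv f t) \<le> (2 * M * (t + h - (t - d)) + e * (1 / \<omega>)) * B"
        by simp
      also have "\<dots> \<le> (4 * M * d + e * (1 / \<omega>)) * k"
      proof -
        have le: "2 * M * (t + h - (t - d)) \<le> 4 * M * d"
          using h const_pos mult_left_mono[of h d "2 * M"] by (simp add: algebra_simps)
        have nonneg: "0 \<le> 4 * M * d + e * (1 / \<omega>)" using d const_pos by simp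
        show ?thesis by (rule mult_mono[OF add_right_mono[OF le] k(2) nonneg B])
      qed
      also have "\<dots> = 3 / 4 * \<epsilon>"
      proof -
        have "4 * M * d * k = \<epsilon> / 2" "e * (1 / \<omega>) * k = \<epsilon> / 4"
          using k const_pos by (simp_all add: d_def e_def)
        then show ?thesis unfolding distrib_right by simp
      qed
      also have "\<dots> < \<epsilon>" using \<open>0 < \<epsilon>\<close> by simp
      finally show ?thesis .
    qed
    then show ?thesis using h0(1) d(1) by (intro exI[of _ "min h0 d"]) auto
  qed
  note unif = this
  show ?thesis
  proof (intro continuous_at_imp_continuous_on ballI continuous_at_eps_delta[THEN iffD2] allI impI)
    fix t \<epsilon> :: real assume "0 < \<epsilon>"
    then obtain \<delta> where \<delta>: "\<delta> > 0" "\<And>t h. 0 \<le> h \<Longrightarrow> h < \<delta> \<Longrightarrow> norm (conv f (t + h) - conv f t) < \<epsilon>"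
      using unif by blast
    have "dist (conv f t') (conv f t) < \<epsilon>" if "dist t' t < \<delta>" for t'
      using \<delta>(2)[of "t' - t" t] \<delta>(2)[of "t - t'" t'] that
      by (cases "t \<le> t'") (auto simp: dist_norm norm_minus_commute)
    then show "\<exists>\<delta>>0. \<forall>t'. dist t' t < \<delta> \<longrightarrow> dist (conv f t') (conv f t) < \<epsilon>"
      using \<delta>(1) by blast
  qed
qed

text \<open>The increment splits into the change of the kernel against \<open>f\<close> and the
  kernel against the change of \<open>f\<close>. The latter may grow like
  \<open>exp (\<omega> / 2 * s)\<close>: half of the decay rate absorbs this, and the other half
  leaves the integral \<open>2 / \<omega>\<close>. The growing term accommodates those
  \<open>s\<close> for which \<open>t - s\<close> is not near infinity.\<close>

lemma conv_shift:
  assumes f: "continuous_on UNIV f" "\<And>s. norm (f s) \<le> B"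
    and e: "0 \<le> e" "(\<integral>\<^sup>+ s. ennreal (G_dist (t + \<tau>) t s) \<partial>lborel) \<le> ennreal e"
    and c: "0 \<le> c" "0 \<le> c'" "\<And>s. 0 \<le> s \<Longrightarrow> norm (f (t + \<tau> - s) - f (t - s)) \<le> c + c' * exp (\<omega> / 2 * s)"
  shows "norm (conv f (t + \<tau>) - conv f t) \<le> B * e + M * c / \<omega> + 2 * M * c' / \<omega>"
proof -
  have B: "0 \<le> B" using f(2)[of 0] norm_ge_zero[of "f 0"] by linarith
  \<comment> \<open>The bound by a real number makes the extended integral finite, so it converts to
    a gauge integral.\<close>
  obtain r where r: "0 \<le> r" "r \<le> e" "(\<integral>\<^sup>+ s. ennreal (G_dist (t + \<tau>) t s) \<partial>lborel) = ennreal r"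
    using e by (cases "\<integral>\<^sup>+ s. ennreal (G_dist (t + \<tau>) t s) \<partial>lborel" rule: ennreal_cases)
      (auto simp: ennreal_le_iff top_unique)
  then have G_int: "(G_dist (t + \<tau>) t has_integral r) UNIV"
    by (intro nn_integral_has_integral) auto
  define b where "b s = B * G_dist (t + \<tau>) t s + (M * c * exp_kernel \<omega> s + M * c' * exp_kernel (\<omega> / 2) s)" for s
  have b_int: "(b has_integral (B * r + (M * c * (1 / \<omega>) + M * c' * (1 / (\<omega> / 2))))) UNIV"
    unfolding b_def using const_pos
    by (intro has_integral_add has_integral_mult_right G_int has_integral_exp_kernel) auto
  have le: "norm (G (t + \<tau>) (t + \<tau> - s) (f (t + \<tau> - s)) - G t (t - s) (f (t - s))) \<le> b s" for s
  proof -
    have "norm ((G (t + \<tau>) (t + \<tau> - s) - G t (t - s)) (f (t + \<tau> - s))) \<le> B * G_dist (t + \<tau>) t s"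
      unfolding G_dist_def
      by (rule order_trans[OF norm_blinfun], subst mult.commute) (intro mult_right_mono f norm_ge_zero)
    moreover have "norm (G t (t - s) (f (t + \<tau> - s) - f (t - s)))
        \<le> M * c * exp_kernel \<omega> s + M * c' * exp_kernel (\<omega> / 2) s"
    proof (cases "0 \<le> s")
      case True
      have "norm (G t (t - s) (f (t + \<tau> - s) - f (t - s)))
          \<le> (M * exp_kernel \<omega> s) * (c + c' * exp (\<omega> / 2 * s))"
        using c True const_pos by (intro order_trans[OF norm_blinfun] mult_mono G_bound) auto
      also have "\<dots> = M * c * exp_kernel \<omega> s + M * c' * (exp (- \<omega> * s) * exp (\<omega> / 2 * s))"
        using True by (simp add: exp_kernel_def algebra_simps)
      also have "exp (- \<omega> * s) * exp (\<omega> / 2 * s) = exp_kernel (\<omega> / 2) s"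
        using True by (simp add: exp_kernel_def flip: exp_add)
      finally show ?thesis .
    qed (simp add: G_def exp_kernel_def)
    moreover have "G (t + \<tau>) (t + \<tau> - s) (f (t + \<tau> - s)) - G t (t - s) (f (t - s))
      = (G (t + \<tau>) (t + \<tau> - s) - G t (t - s)) (f (t + \<tau> - s)) + G t (t - s) (f (t + \<tau> - s) - f (t - s))"
      by (simp add: blinfun.diff_left blinfun.diff_right)
    ultimately show ?thesis unfolding b_def by (metis norm_triangle_mono)
  qed
  have conv_eq: "conv f (t + \<tau>) - conv f t
      = integral UNIV (\<lambda>s. G (t + \<tau>) (t + \<tau> - s) (f (t + \<tau> - s)) - G t (t - s) (f (t - s)))"
    unfolding conv_def by (rule integral_diff[symmetric]) (intro conv_integrable[OF f])+
  have "norm (conv f (t + \<tau>) - conv f t) \<le> integral UNIV b"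
    unfolding conv_eq using b_int
    by (intro integral_norm_bound_integral integrable_diff conv_integrable[OF f] le) auto
  also have "\<dots> = B * r + M * c / \<omega> + 2 * M * c' / \<omega>"
    using integral_unique[OF b_int] by (simp add: mult_ac)
  also have "\<dots> \<le> B * e + M * c / \<omega> + 2 * M * c' / \<omega>"
    using r B by (simp add: mult_left_mono)
  finally show ?thesis .
qed

section \<open>Almost periods near infinity\<close>

text \<open>Both periods are used at the base point \<open>t - y\<close>, which is why the threshold
  grows by \<open>\<bar>y\<bar>\<close>; the triangle inequality passes through that point.\<close>

lemma nn_integral_G_dist_diff:
  assumes x: "\<exists>T>0. \<forall>t. T \<le> \<bar>t\<bar> \<longrightarrow> (\<integral>\<^sup>+ s. ennreal (G_dist (t + x) t s) \<partial>lborel) \<le> ennreal d"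
    and y: "\<exists>T>0. \<forall>t. T \<le> \<bar>t\<bar> \<longrightarrow> (\<integral>\<^sup>+ s. ennreal (G_dist (t + y) t s) \<partial>lborel) \<le> ennreal e"
    and de: "0 \<le> d" "0 \<le> e"
  shows "\<exists>T>0. \<forall>t. T \<le> \<bar>t\<bar> \<longrightarrow> (\<integral>\<^sup>+ s. ennreal (G_dist (t + (x - y)) t s) \<partial>lborel) \<le> ennreal (d + e)"
proof -
  obtain T where T: "T > 0" "\<And>t. T \<le> \<bar>t\<bar> \<Longrightarrow> (\<integral>\<^sup>+ s. ennreal (G_dist (t + x) t s) \<partial>lborel) \<le> ennreal d"
    using x by blast
  obtain T' where T': "T' > 0" "\<And>t. T' \<le> \<bar>t\<bar> \<Longrightarrow> (\<integral>\<^sup>+ s. ennreal (G_dist (t + y) t s) \<partial>lborel) \<le> ennreal e"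
    using y by blast
  show ?thesis
  proof (intro exI[of _ "max T T' + \<bar>y\<bar>"] conjI allI impI)
    fix t assume t: "max T T' + \<bar>y\<bar> \<le> \<bar>t\<bar>"
    define t' where "t' = t - y"
    have t': "T \<le> \<bar>t'\<bar>" "T' \<le> \<bar>t'\<bar>" using t by (auto simp: t'_def)
    have "(\<integral>\<^sup>+ s. ennreal (G_dist (t' + x) (t' + y) s) \<partial>lborel)
        \<le> (\<integral>\<^sup>+ s. ennreal (G_dist (t' + x) t' s) \<partial>lborel) + (\<integral>\<^sup>+ s. ennreal (G_dist t' (t' + y) s) \<partial>lborel)"
      by (rule nn_integral_G_dist_triangle)
    also have "\<dots> \<le> ennreal d + ennreal e"
      unfolding nn_integral_G_dist_commute[of t'] using t' by (intro add_mono T T')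
    also have "\<dots> = ennreal (d + e)"
      using de by simp
    finally show "(\<integral>\<^sup>+ s. ennreal (G_dist (t + (x - y)) t s) \<partial>lborel) \<le> ennreal (d + e)"
      by (simp add: t'_def algebra_simps)
  qed (use T in auto)
qed

text \<open>
  A bound \<open>c\<close> on the increments of the fixed point near infinity improves to one of the form
  \<open>const * e + c / 2\<close>; iterating removes the dependence on the initial bound.
\<close>

lemma fixed_point_almost_period:
  fixes F :: "real \<Rightarrow> 'a \<Rightarrow> 'a"
  defines "f \<equiv> \<lambda>u s. F s (u s)"
  assumes fix_u: "\<And>t. u t = conv (f u) t"
    and u: "\<And>t. norm (u t) \<le> B'"
    and fu: "continuous_on UNIV (f u)" "\<And>s. norm (f u s) \<le> B"
    and L: "0 \<le> L" "M * L / \<omega> \<le> 1 / 2" "\<And>t y z. norm (F t y - F t z) \<le> L * norm (y - z)"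
    and F_period: "\<exists>T>0. \<forall>t. T \<le> \<bar>t\<bar> \<longrightarrow> (\<forall>x. norm (F (t + \<tau>) x - F t x) \<le> e)"
    and G_period: "\<exists>T>0. \<forall>t. T \<le> \<bar>t\<bar> \<longrightarrow> (\<integral>\<^sup>+ s. ennreal (G_dist (t + \<tau>) t s) \<partial>lborel) \<le> ennreal e"
    and e: "0 < e"
  shows "\<exists>T>0. \<forall>t. T \<le> \<bar>t\<bar> \<longrightarrow> norm (u (t + \<tau>) - u t) \<le> (2 * (B + M / \<omega> + 1) + 1) * e"
proof -
  define A where "A = (B + M / \<omega> + 1) * e"
  have B: "0 \<le> B" using fu(2)[of 0] norm_ge_zero[of "f u 0"] by linarith
  have B': "0 \<le> B'" using u[of 0] norm_ge_zero[of "u 0"] by linarith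
  have A: "0 \<le> A" using B const_pos e by (simp add: A_def)
  obtain T1 where T1: "T1 > 0" "\<And>t x. T1 \<le> \<bar>t\<bar> \<Longrightarrow> norm (F (t + \<tau>) x - F t x) \<le> e"
    using F_period by blast
  obtain T2 where T2: "T2 > 0"
      "\<And>t. T2 \<le> \<bar>t\<bar> \<Longrightarrow> (\<integral>\<^sup>+ s. ennreal (G_dist (t + \<tau>) t s) \<partial>lborel) \<le> ennreal e"
    using G_period by blast
  define S where "S c \<longleftrightarrow> (\<exists>T>0. \<forall>t. T \<le> \<bar>t\<bar> \<longrightarrow> norm (u (t + \<tau>) - u t) \<le> c)" for c
  have step: "S (A + c / 2)" if "S c" "0 \<le> c" for c
  proof -
    obtain T3 where T3: "T3 > 0" "\<And>t. T3 \<le> \<bar>t\<bar> \<Longrightarrow> norm (u (t + \<tau>) - u t) \<le> c"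
      using \<open>S c\<close> unfolding S_def by blast
    define T where "T = max T1 (max T2 T3)"
    \<comment> \<open>Chosen so that \<open>4 * M * B / \<omega> * exp (- y)\<close> equals
      \<open>e * y * exp (- y)\<close>, which is at most \<open>e\<close>; \<open>X\<close> is the
      age at which the factor \<open>exp (- (\<omega> / 2 * X))\<close> reaches this size.\<close>
    define y where "y = 4 * M * B / (\<omega> * e)"
    have y: "0 \<le> y" using const_pos B e by (simp add: y_def)
    define X where "X = 2 / \<omega> * y"
    have X: "0 \<le> X" using y const_pos by (simp add: X_def)
    define c' where "c' = 2 * B * exp (- (\<omega> / 2 * X))"
    have c': "0 \<le> c'" "2 * M * c' / \<omega> \<le> e"
    proof -
      show "0 \<le> c'" using B by (simp add: c'_def)
      have "\<omega> / 2 * X = y" using const_pos by (simp add: X_def)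
      then have "2 * M * c' / \<omega> = 4 * M * B / \<omega> * exp (- y)" by (simp add: c'_def)
      also have "\<dots> = e * y * exp (- y)" using const_pos e by (simp add: y_def)
      also have "\<dots> \<le> e * exp y * exp (- y)"
      proof (intro mult_right_mono mult_left_mono)
        show "y \<le> exp y" using exp_ge_add_one_self[of y] by linarith
      qed (use e in auto)
      also have "\<dots> = e" by (simp add: exp_minus)
      finally show "2 * M * c' / \<omega> \<le> e" .
    qed
    have "norm (u (t + \<tau>) - u t) \<le> A + c / 2" if t: "T + X \<le> \<bar>t\<bar>" for t
    proof -
      \<comment> \<open>Where \<open>t - s\<close> is still near infinity, the Lipschitz bound and
        the period of \<open>F\<close> apply. Otherwise \<open>s \<ge> X\<close>, and the trivial
        bound \<open>2 * B = c' * exp (\<omega> / 2 * X)\<close> goes into the growing term.\<close>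
      have inc: "norm (f u (t + \<tau> - s) - f u (t - s)) \<le> (L * c + e) + c' * exp (\<omega> / 2 * s)"
        if "0 \<le> s" for s
      proof (cases "T \<le> \<bar>t - s\<bar>")
        case True
        define r where "r = t - s"
        have r: "T1 \<le> \<bar>r\<bar>" "T3 \<le> \<bar>r\<bar>" using True by (auto simp: T_def r_def)
        have "f u (t + \<tau> - s) - f u (t - s)
            = (F (r + \<tau>) (u (r + \<tau>)) - F (r + \<tau>) (u r)) + (F (r + \<tau>) (u r) - F r (u r))"
          by (simp add: f_def r_def algebra_simps)
        also have "norm \<dots> \<le> L * c + e"
          using r by (intro norm_triangle_mono T1 order_trans[OF L(3)] mult_left_mono T3 L)
        finally show ?thesis using c' by (simp add: add_increasing2)
      next
        case False
        then have s: "X \<le> s" using t that T1 X by (auto simp: T_def abs_if split: if_splits)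
        have "norm (f u (t + \<tau> - s) - f u (t - s)) \<le> 2 * B"
          using norm_triangle_ineq4[of "f u (t + \<tau> - s)" "f u (t - s)"] fu(2)[of "t + \<tau> - s"] fu(2)[of "t - s"]
          by linarith
        also have "\<dots> = c' * exp (\<omega> / 2 * X)" by (simp add: c'_def exp_minus)
        also have "\<dots> \<le> c' * exp (\<omega> / 2 * s)"
          using s const_pos c' by (intro mult_left_mono) auto
        finally show ?thesis using L(1) \<open>0 \<le> c\<close> e by (smt (verit) mult_nonneg_nonneg)
      qed
      have "norm (conv (f u) (t + \<tau>) - conv (f u) t) \<le> B * e + M * (L * c + e) / \<omega> + 2 * M * c' / \<omega>"
        using e L(1) \<open>0 \<le> c\<close> c' t X
        by (intro conv_shift fu inc T2) (auto simp: T_def)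
      also have "\<dots> \<le> B * e + (M / \<omega> * e + 1 / 2 * c) + e"
      proof -
        have "M * (L * c + e) / \<omega> = M * L / \<omega> * c + M / \<omega> * e"
          by (simp add: distrib_left add_divide_distrib)
        then show ?thesis using mult_right_mono[OF L(2) \<open>0 \<le> c\<close>] c'(2) by linarith
      qed
      also have "\<dots> = A + c / 2" by (simp add: A_def algebra_simps)
      finally show ?thesis by (simp flip: fix_u)
    qed
    moreover have "0 < T + X" using T1 X by (simp add: T_def less_max_iff_disj add_pos_nonneg)
    ultimately show ?thesis unfolding S_def by blast
  qed
  \<comment> \<open>The improvement \<open>A + c / 2\<close> has the fixed point
    \<open>2 * A\<close>; the excess over it is halved at each step, starting from the trivial bound
    \<open>2 * B'\<close>.\<close>
  have iter: "S (2 * A + 2 * B' / 2 ^ n)" for n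
  proof (induction n)
    case 0
    have "norm (u (t + \<tau>) - u t) \<le> 2 * A + 2 * B'" for t
      using norm_triangle_ineq4[of "u (t + \<tau>)" "u t"] u[of "t + \<tau>"] u[of t] A by linarith
    then show ?case unfolding S_def by (intro exI[of _ 1]) auto
  next
    case (Suc n)
    have "S (A + (2 * A + 2 * B' / 2 ^ n) / 2)"
      using A B' by (intro step Suc.IH) auto
    then show ?case by (simp add: add_divide_distrib)
  qed
  have "(\<lambda>n. 2 * B' * (1 / 2) ^ n) \<longlonglongrightarrow> 2 * B' * 0"
    by (intro tendsto_intros LIMSEQ_power_zero) auto
  then have "eventually (\<lambda>n. 2 * B' * (1 / 2) ^ n < e) sequentially"
    using e by (intro order_tendstoD(2)) auto
  then obtain n where "2 * B' * (1 / 2) ^ n < e"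
    by (auto simp: eventually_sequentially)
  then have "2 * A + 2 * B' / 2 ^ n \<le> (2 * (B + M / \<omega> + 1) + 1) * e"
    by (simp add: A_def power_divide algebra_simps)
  then show ?thesis using iter[of n] unfolding S_def by (meson order_trans)
qed

end

subsection \<open>Evolution systems generated by Acquistapace--Terreni operators\<close>

lemma resolvent_props:
  assumes "z \<in> resolvent_set D A"
  shows "resolvent z D A x \<in> D"
    and "z *\<^sub>C resolvent z D A x - A (resolvent z D A x) = x"
    and "y \<in> D \<Longrightarrow> resolvent z D A (z *\<^sub>C y - A y) = y"
proof -
  let ?f = "\<lambda>x. z *\<^sub>C x - A x"
  have bij: "bij_betw ?f D UNIV" and bl: "bounded_linear (the_inv_into D ?f)"
    using assms by (auto simp: resolvent_set_def)
  have app: "resolvent z D A x = the_inv_into D ?f x" for x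
    unfolding resolvent_def by (simp add: bounded_linear_Blinfun_apply[OF bl])
  show "resolvent z D A x \<in> D"
    unfolding app using bij by (intro the_inv_into_into) (auto simp: bij_betw_def)
  show "z *\<^sub>C resolvent z D A x - A (resolvent z D A x) = x"
    unfolding app using f_the_inv_into_f_bij_betw[OF bij, of x] by simp
  show "resolvent z D A (z *\<^sub>C y - A y) = y" if "y \<in> D"
    unfolding app using the_inv_into_f_f[of ?f D y] bij that by (simp add: bij_betw_def)
qed

lemma resolvent_shift:
  fixes A :: "'a::complex_banach \<Rightarrow> 'a"
  shows "resolvent z D (\<lambda>x. A x - w *\<^sub>C x) = resolvent (z + w) D A"
    and "z \<in> resolvent_set D (\<lambda>x. A x - w *\<^sub>C x) \<longleftrightarrow> z + w \<in> resolvent_set D A"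
proof -
  have "(\<lambda>x. z *\<^sub>C x - (A x - w *\<^sub>C x)) = (\<lambda>x. (z + w) *\<^sub>C x - A x)"
    by (simp add: fun_eq_iff scaleC_add_left)
  then show "resolvent z D (\<lambda>x. A x - w *\<^sub>C x) = resolvent (z + w) D A"
    "z \<in> resolvent_set D (\<lambda>x. A x - w *\<^sub>C x) \<longleftrightarrow> z + w \<in> resolvent_set D A"
    by (simp_all add: resolvent_def resolvent_set_def)
qed

lemma nonneg_real_in_closure_sector:
  assumes "0 < \<phi>" "0 \<le> l"
  shows "complex_of_real l \<in> closure (sector \<phi>)"
proof -
  have pos: "complex_of_real x \<in> sector \<phi>" if "0 < x" for x
    using that assms Arg_of_real[of x] by (simp add: sector_def)
  have "\<exists>z\<in>sector \<phi>. dist z (complex_of_real l) < e" if "0 < e" for e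
    using pos[of "l + e / 2"] that assms
    by (intro bexI[of _ "complex_of_real (l + e / 2)"]) (auto simp: dist_norm)
  then show ?thesis by (simp add: closure_approachable)
qed

text \<open>\<open>R l t\<close> is the resolvent of \<open>B t\<close>, the generator shifted by
  \<open>\<omega>\<^sub>0\<close>. Both \<open>R_V\<close> and \<open>R_change\<close> come from the
  second Acquistapace--Terreni estimate, by writing differences of generators at two times through
  differences of their inverses.\<close>

lemma parabolic_evolution_of_generator:
  fixes D :: "real \<Rightarrow> 'a::complex_banach set"
  assumes H1: "acquistapace_terreni D A \<omega>\<^sub>0 \<phi> \<mu> \<nu>"
    and evol: "evolution_system U"
    and gen: "generates D A U"
    and stable: "exponentially_stable U M \<omega>"
  shows "\<exists>V R C K. parabolic_evolution U V R M \<omega> C K \<omega>\<^sub>0 \<mu> \<nu>"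
proof -
  define B where "B t x = A t x - complex_of_real \<omega>\<^sub>0 *\<^sub>C x" for t x
  have num: "0 \<le> \<omega>\<^sub>0" "pi / 2 < \<phi>" "0 < \<mu>" "0 < \<nu>" "1 < \<mu> + \<nu>"
    using H1 by (auto simp: acquistapace_terreni_def)
  have sector: "complex_of_real l \<in> closure (sector \<phi>)" if "0 \<le> l" for l
  proof (rule nonneg_real_in_closure_sector)
    show "0 < \<phi>" using num pi_gt_zero by linarith
  qed (rule that)
  have B_eq: "(\<lambda>x. A t x - complex_of_real \<omega>\<^sub>0 *\<^sub>C x) = B t" for t
    by (simp add: B_def fun_eq_iff)
  have res: "complex_of_real l \<in> resolvent_set (D t) (B t)" if "0 \<le> l" for l t
    using H1 sector[OF that] by (auto simp: acquistapace_terreni_def Let_def B_eq)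
  define R where "R l t = resolvent (complex_of_real l) (D t) (B t)" for l t
  \<comment> \<open>Up to sign the inverse of the shifted generator; it is also the resolvent of
    \<open>A t\<close> at \<open>\<omega>\<^sub>0\<close>, which occurs in the Acquistapace--Terreni
    estimate.\<close>
  define S where "S t = resolvent 0 (D t) (B t)" for t
  have R_D: "R l t x \<in> D t"
    and R_eq: "l *\<^sub>R R l t x - B t (R l t x) = x"
    and R_inv: "y \<in> D t \<Longrightarrow> R l t (l *\<^sub>R y - B t y) = y" if "0 \<le> l" for l t x y
    using resolvent_props[OF res[OF that, of t]] by (simp_all add: R_def scaleC_of_real)
  have S_R: "S = R 0" by (simp add: S_def R_def fun_eq_iff)
  have S_D: "S t x \<in> D t" and S_eq: "B t (S t x) = - x" and S_inv: "y \<in> D t \<Longrightarrow> S t (B t y) = - y" for t x y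
    using R_D[of 0] R_eq[of 0 t x] R_inv[of 0 y t] unfolding S_R
    by (auto simp: blinfun.minus_right minus_equation_iff[of _ x] minus_equation_iff[of _ y])
  have S_A: "resolvent (complex_of_real \<omega>\<^sub>0) (D t) (A t) = S t" for t
    using resolvent_shift(1)[of 0 "D t" "A t" "complex_of_real \<omega>\<^sub>0"] by (simp add: S_def B_eq)
  have "\<exists>K. \<forall>t. \<forall>z\<in>closure (sector \<phi>). norm (resolvent z (D t) (B t)) \<le> K / (1 + cmod z)"
    using H1 by (simp add: acquistapace_terreni_def Let_def B_eq)
  then obtain K1 where K1: "\<forall>t. \<forall>z\<in>closure (sector \<phi>).
      norm (resolvent z (D t) (B t)) \<le> K1 / (1 + cmod z)" by blast
  have R_norm: "norm (R l t) \<le> K1 / (1 + l)" if "0 \<le> l" for l t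
    using K1[rule_format, OF sector[OF that], of t] that by (simp add: R_def)
  have S_norm: "norm (S t) \<le> K1" for t
    using R_norm[of 0 t] by (simp add: S_R)
  have K1_nonneg: "0 \<le> K1" using S_norm[of 0] norm_ge_zero[of "S 0"] by linarith
  have "\<exists>K. \<forall>t s. \<forall>z\<in>closure (sector \<phi>) - {0}. \<forall>x.
      norm (B t (resolvent z (D t) (B t) (S t x - S s x))) \<le> K * \<bar>t - s\<bar> powr \<mu> * cmod z powr (- \<nu>) * norm x"
    using H1 by (simp add: acquistapace_terreni_def Let_def B_eq S_A)
  then obtain K2' where K2': "\<forall>t s. \<forall>z\<in>closure (sector \<phi>) - {0}. \<forall>x.
      norm (B t (resolvent z (D t) (B t) (S t x - S s x))) \<le> K2' * \<bar>t - s\<bar> powr \<mu> * cmod z powr (- \<nu>) * norm x"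
    by blast
  \<comment> \<open>The constant given by the hypothesis is not known to be nonnegative.\<close>
  define K2 where "K2 = max 0 K2'"
  have K2: "norm (B t (R l t (S t x - S s x))) \<le> K2 * \<bar>t - s\<bar> powr \<mu> * l powr (- \<nu>) * norm x"
    if "0 < l" for t s l x
  proof -
    have "norm (B t (R l t (S t x - S s x))) \<le> K2' * \<bar>t - s\<bar> powr \<mu> * l powr (- \<nu>) * norm x"
      using K2'[rule_format, where z = "complex_of_real l" and t = t and s = s and x = x] sector[of l] that by (simp add: R_def)
    also have "\<dots> \<le> K2 * \<bar>t - s\<bar> powr \<mu> * l powr (- \<nu>) * norm x"
      by (intro mult_right_mono) (auto simp: K2_def)
    finally show ?thesis .
  qed
  obtain V C where V: "\<forall>t s x. s < t \<longrightarrow> U t s x \<in> D t \<and> blinfun_apply (V t s) x = A t (U t s x)"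
      "\<forall>t s. s < t \<longrightarrow> ((\<lambda>r. U r s) has_vector_derivative V t s) (at t)"
    and C: "\<forall>t s. s < t \<and> t \<le> s + 1 \<longrightarrow> norm (U t s) \<le> C \<and> norm (V t s) \<le> C / (t - s)"
    using gen unfolding generates_def by - (elim conjE exE, rule that)
  have UV_bound: "norm (U t s) \<le> C" "norm (V t s) \<le> C / (t - s)" if "s < t" "t \<le> s + 1" for s t
    using C that by auto
  have C_nonneg: "0 \<le> C" by (rule order_trans[OF norm_ge_zero UV_bound(1)[of 0 1]]) auto
  have gen_lim: "((\<lambda>t. resolvent z (D s) (A s) (U t s x)) \<longlongrightarrow> resolvent z (D s) (A s) x) (at_right s)"
    if "z \<in> resolvent_set (D s) (A s)" for s x z
    using gen that unfolding generates_def by blast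
  \<comment> \<open>One summand each for \<open>R_bound\<close>, \<open>R_V\<close> and
    \<open>R_change\<close>.\<close>
  define K where "K = K1 + K2 * (C * (1 + \<omega>\<^sub>0)) + (1 + K1)\<^sup>2 * (1 + K2)"
  have K2_nonneg: "0 \<le> K2" by (simp add: K2_def)
  have pos: "0 < M" "0 < \<omega>"
    using stable by (auto simp: exponentially_stable_def hyperbolic_def)
  have U_bound: "norm (U t s) \<le> M * exp (- \<omega> * (t - s))" if "s \<le> t" for t s
  proof -
    have "U t s o\<^sub>L id_blinfun = U t s" by (rule blinfun_eqI) simp
    moreover have "norm (U t s o\<^sub>L id_blinfun) \<le> M * exp (- \<omega> * (t - s))"
      using stable that unfolding exponentially_stable_def hyperbolic_def by blast
    ultimately show ?thesis by simp
  qed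
  have R_via_S: "R l t y = S t y - l *\<^sub>R R l t (S t y)" if "0 \<le> l" for l t y
    using R_inv[OF that S_D[of t y]] by (simp add: S_eq blinfun.add_right blinfun.scaleR_right algebra_simps)
  have B_R: "B t (R l t x) = l *\<^sub>R R l t x - x" if "0 \<le> l" for l t x
    using R_eq[OF that, of t x] by (simp add: algebra_simps)
  have "parabolic_evolution U V R M \<omega> C K \<omega>\<^sub>0 \<mu> \<nu>"
  proof
    show "0 \<le> K" using K1_nonneg K2_nonneg C_nonneg num by (simp add: K_def)
    show "U t s = U t r o\<^sub>L U r s" if "s \<le> r" "r \<le> t" for t r s
      using evol that by (auto simp: evolution_system_def)
    show "norm (V t s) \<le> C / (t - s)" if "s < t" "t \<le> s + 1" for t s using UV_bound(2) that .
    show "norm (R l s) \<le> K / l" if "0 < l" for l s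
    proof -
      have "norm (R l s) \<le> K1 / (1 + l)" using that by (intro R_norm) auto
      also have "\<dots> \<le> K / l"
        using K1_nonneg K2_nonneg C_nonneg num that by (intro frac_le) (auto simp: K_def)
      finally show ?thesis .
    qed
    show "norm (R l s (V t s x) - (l + \<omega>\<^sub>0) *\<^sub>R R l s (U t s x) + U t s x)
        \<le> K * (t - s) powr (\<mu> - 1) * l powr (- \<nu>) * norm x" if l: "0 < l" and st: "s < t" "t \<le> s + 1" for l s t x
    proof -
      define w where "w = U t s x"
      define v where "v = V t s x - \<omega>\<^sub>0 *\<^sub>R w"
      have w: "w \<in> D t" "v = B t w" using V(1)[rule_format, OF st(1), of x] by (auto simp: w_def v_def B_def scaleC_of_real)
      \<comment> \<open>Replacing \<open>w\<close> by \<open>- S t v\<close> turns the defect into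
        \<open>- B s (R l s (S s v - S t v))\<close>, the expression estimated by \<open>K2\<close>.
        The singular bound on \<open>v\<close> then lowers the exponent from \<mu> to
        \<open>\<mu> - 1\<close>.\<close>
      have "S t v = - w" using S_inv w by simp
      then have "B s (R l s (S s v - S t v)) = l *\<^sub>R R l s (S s v) + l *\<^sub>R R l s w - S s v - w"
        using B_R[of l s "S s v + w"] l by (simp add: blinfun.add_right scaleR_right_distrib)
      moreover have "R l s v = S s v - l *\<^sub>R R l s (S s v)" using l by (intro R_via_S) simp
      ultimately have "R l s v - l *\<^sub>R R l s w + w = - B s (R l s (S s v - S t v))"
        by simp
      moreover have "R l s (V t s x) - (l + \<omega>\<^sub>0) *\<^sub>R R l s (U t s x) + U t s x = R l s v - l *\<^sub>R R l s w + w"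
        by (simp add: v_def w_def blinfun.diff_right blinfun.scaleR_right algebra_simps)
      ultimately have "norm (R l s (V t s x) - (l + \<omega>\<^sub>0) *\<^sub>R R l s (U t s x) + U t s x)
          = norm (B s (R l s (S s v - S t v)))" by simp
      also have "\<dots> \<le> K2 * \<bar>s - t\<bar> powr \<mu> * l powr (- \<nu>) * norm v"
        by (rule K2[OF l])
      also have "norm v \<le> C * (1 + \<omega>\<^sub>0) / (t - s) * norm x"
      proof -
        have "norm v \<le> C / (t - s) * norm x + \<omega>\<^sub>0 * (C * norm x)"
          unfolding v_def w_def
        proof (intro order_trans[OF norm_triangle_ineq4] add_mono)
          show "norm (V t s x) \<le> C / (t - s) * norm x"
            by (intro order_trans[OF norm_blinfun] mult_right_mono UV_bound st norm_ge_zero)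
          have "norm (U t s x) \<le> C * norm x"
            by (intro order_trans[OF norm_blinfun] mult_right_mono UV_bound st norm_ge_zero)
          then show "norm (\<omega>\<^sub>0 *\<^sub>R U t s x) \<le> \<omega>\<^sub>0 * (C * norm x)"
            using num by (simp add: mult_left_mono)
        qed
        \<comment> \<open>Since \<open>t - s \<le> 1\<close>, the shift term may be divided by
          \<open>t - s\<close> and merged with the singular one.\<close>
        also have "\<omega>\<^sub>0 * (C * norm x) \<le> \<omega>\<^sub>0 * (C * norm x) / (t - s)"
        proof -
          have "\<omega>\<^sub>0 * (C * norm x) * (t - s) \<le> \<omega>\<^sub>0 * (C * norm x) * 1"
            using st num C_nonneg by (intro mult_left_mono) auto
          then show ?thesis using st by (simp add: pos_le_divide_eq)
        qed
        finally show ?thesis by (simp add: add_divide_distrib algebra_simps)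
      qed
      then have "K2 * \<bar>s - t\<bar> powr \<mu> * l powr (- \<nu>) * norm v
          \<le> K2 * \<bar>s - t\<bar> powr \<mu> * l powr (- \<nu>) * (C * (1 + \<omega>\<^sub>0) / (t - s) * norm x)"
        using K2_nonneg by (intro mult_left_mono) auto
      also have "\<dots> = K2 * (C * (1 + \<omega>\<^sub>0)) * (t - s) powr (\<mu> - 1) * l powr (- \<nu>) * norm x"
        using st by (simp add: powr_diff)
      also have "\<dots> \<le> K * (t - s) powr (\<mu> - 1) * l powr (- \<nu>) * norm x"
        using K1_nonneg K2_nonneg by (intro mult_right_mono) (auto simp: K_def)
      finally show ?thesis .
    qed
    show "norm (R l r y) \<le> K * (norm (R 1 s y) + \<bar>r - s\<bar> powr \<mu> * norm y)" if l: "0 < l" for l r s y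
    proof -
      \<comment> \<open>\<open>S r y\<close> is compared with \<open>S s y\<close>. The estimate
        controls \<open>e\<close> only, and \<open>d = - S r e - e\<close> recovers \<open>d\<close>
        from it; likewise \<open>S s y = S s q + q\<close> is controlled by
        \<open>q = R 1 s y\<close>.\<close>
      define d where "d = S r y - S s y"
      define e where "e = B r (R 1 r d)"
      have e: "norm e \<le> K2 * \<bar>r - s\<bar> powr \<mu> * norm y"
        using K2[of 1 r y s] by (simp add: e_def d_def)
      have S_le: "norm (S t x) \<le> K1 * norm x" for t x
        by (rule order_trans[OF norm_blinfun]) (intro mult_right_mono S_norm norm_ge_zero)
      have "S r e = - R 1 r d" unfolding e_def by (intro S_inv R_D) simp
      then have "d = - S r e - e"
        using B_R[of 1 r d] by (simp add: e_def)
      then have "norm d \<le> norm (S r e) + norm e"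
        using norm_triangle_ineq4[of "- S r e" e] by simp
      then have d: "norm d \<le> (1 + K1) * norm e"
        using S_le[of r e] by (simp add: algebra_simps)
      define q where "q = R 1 s y"
      have "y = q - B s q" using B_R[of 1 s y] by (simp add: q_def)
      moreover have "S s (B s q) = - q" unfolding q_def by (intro S_inv R_D) simp
      ultimately have "S s y = S s q + q" by (metis blinfun.diff_right diff_minus_eq_add)
      then have Ss: "norm (S s y) \<le> (1 + K1) * norm q"
        using norm_triangle_ineq[of "S s q" q] S_le[of s q] by (simp add: algebra_simps)
      have "norm (S r y) \<le> norm d + norm (S s y)"
        using norm_triangle_ineq[of d "S s y"] by (simp add: d_def)
      also have "\<dots> \<le> (1 + K1) * (K2 * \<bar>r - s\<bar> powr \<mu> * norm y) + (1 + K1) * norm q"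
        using K1_nonneg by (intro add_mono Ss order_trans[OF d] mult_left_mono e) auto
      also have "\<dots> \<le> (1 + K1) * ((1 + K2) * (norm q + \<bar>r - s\<bar> powr \<mu> * norm y))"
      proof -
        have "K2 * \<bar>r - s\<bar> powr \<mu> * norm y + norm q \<le> (1 + K2) * (norm q + \<bar>r - s\<bar> powr \<mu> * norm y)"
          using K2_nonneg by (simp add: algebra_simps)
        from mult_left_mono[OF this, of "1 + K1"] K1_nonneg show ?thesis by (simp add: distrib_left)
      qed
      finally have Sr: "norm (S r y) \<le> (1 + K1) * ((1 + K2) * (norm q + \<bar>r - s\<bar> powr \<mu> * norm y))" .
      have "norm (R l r (S r y)) \<le> K1 / (1 + l) * norm (S r y)"
        using l by (intro order_trans[OF norm_blinfun] mult_right_mono R_norm) auto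
      from mult_left_mono[OF this, of l]
      have "norm (l *\<^sub>R R l r (S r y)) \<le> l / (1 + l) * (K1 * norm (S r y))"
        using l by (simp add: mult_ac)
      also have "\<dots> \<le> 1 * (K1 * norm (S r y))"
        using l K1_nonneg by (intro mult_right_mono) auto
      finally have "norm (S r y) + norm (l *\<^sub>R R l r (S r y)) \<le> (1 + K1) * norm (S r y)"
        by (simp add: distrib_right)
      moreover have "R l r y = S r y - l *\<^sub>R R l r (S r y)" using l by (intro R_via_S) simp
      ultimately have "norm (R l r y) \<le> (1 + K1) * norm (S r y)"
        using norm_triangle_ineq4[of "S r y" "l *\<^sub>R R l r (S r y)"] by (metis order_trans)
      also have "\<dots> \<le> (1 + K1) * ((1 + K1) * ((1 + K2) * (norm q + \<bar>r - s\<bar> powr \<mu> * norm y)))"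
        using K1_nonneg by (intro mult_left_mono Sr) auto
      also have "\<dots> = ((1 + K1)\<^sup>2 * (1 + K2)) * (norm q + \<bar>r - s\<bar> powr \<mu> * norm y)"
        by (simp only: power2_eq_square mult.assoc)
      also have "\<dots> \<le> K * (norm q + \<bar>r - s\<bar> powr \<mu> * norm y)"
        using K1_nonneg K2_nonneg C_nonneg num by (intro mult_right_mono) (auto simp: K_def)
      finally show ?thesis by (simp add: q_def)
    qed
    show "((\<lambda>t. R l s (U t s x)) \<longlongrightarrow> R l s x) (at_right s)" if "0 < l" for l s x
    proof -
      have "complex_of_real l + complex_of_real \<omega>\<^sub>0 \<in> resolvent_set (D s) (A s)"
        using res[of l s] that resolvent_shift(2)[of "complex_of_real l" "D s" "A s" "complex_of_real \<omega>\<^sub>0"]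
        by (simp add: B_eq)
      from gen_lim[OF this, of x] show ?thesis
        using resolvent_shift(1)[of "complex_of_real l" "D s" "A s" "complex_of_real \<omega>\<^sub>0"]
        by (simp add: R_def B_eq)
    qed
  qed (use num pos C_nonneg U_bound V(2) in auto)
  then show ?thesis by blast
qed

text \<open>The complementary projections vanish, so the inverse is taken on \<open>{0}\<close>,
  where \<open>the_inv_into\<close> returns 0.\<close>

lemma green_exponentially_stable:
  "green U (\<lambda>t. id_blinfun) t s = (if s \<le> t then U t s else 0)"
proof (cases "s \<le> t")
  case True
  then show ?thesis by (auto simp: green_def intro: blinfun_eqI)
next
  case False
  have "inv_Q U (\<lambda>t. id_blinfun) t s (compl_proj (\<lambda>t. id_blinfun) s x) = 0" for x
  proof -
    have r: "range (compl_proj (\<lambda>t. id_blinfun) t) = {0}" for t :: real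
      by (auto simp: compl_proj_def)
    have "the_inv_into {0} (U s t) (U s t 0) = 0" by (rule the_inv_into_f_f) auto
    then show ?thesis unfolding inv_Q_def r by (simp add: compl_proj_def blinfun.zero_right)
  qed
  then show ?thesis using False by (simp add: green_def flip: zero_blinfun_def)
qed

subsection \<open>Mild solutions\<close>

theorem theorem4p7:
  fixes D :: "real \<Rightarrow> 'a::complex_banach set"
    and A :: "real \<Rightarrow> 'a \<Rightarrow> 'a"
    and U :: "real \<Rightarrow> real \<Rightarrow> ('a \<Rightarrow>\<^sub>L 'a)"
    and \<Gamma> :: "real \<Rightarrow> real \<Rightarrow> ('a \<Rightarrow>\<^sub>L 'a)"
    and F :: "real \<Rightarrow> 'a \<Rightarrow> 'a"
    and \<omega>\<^sub>0 \<phi> \<mu> \<nu> M' \<omega> L :: real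
  assumes nontrivial: "\<exists>x::'a. x \<noteq> 0"
    and closed_op: "\<And>t. closed_linear_operator (D t) (A t)"
    and H1: "acquistapace_terreni D A \<omega>\<^sub>0 \<phi> \<mu> \<nu>"
    and evol: "evolution_system U"
    and gen: "generates D A U"
    and stable: "exponentially_stable U M' \<omega>"
    and Green: "\<Gamma> = green U (\<lambda>t. id_blinfun)"
    and F_QAAP: "F \<in> QAAP_param"
    and F_0_bounded: "bounded (range (\<lambda>t. F t 0))"
    and Green_QAAP: "\<forall>\<epsilon>>0. \<exists>l>0. \<forall>a. \<exists>\<tau>\<in>{a..a + l}. \<exists>M>0. \<forall>t. M \<le> \<bar>t\<bar> \<longrightarrow>
        (\<integral>\<^sup>+ s. ennreal (norm (\<Gamma> (t + \<tau>) (t + \<tau> - s) - \<Gamma> t (t - s))) \<partial>lborel) \<le> ennreal \<epsilon>"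
    and L_bounds: "0 < L" "L < \<omega> / (2 * M')"
    and Lipschitz: "\<And>t y z. norm (F t y - F t z) \<le> L * norm (y - z)"
  shows "\<exists>!u. mild_solution \<Gamma> F u \<and> u \<in> QAAP"
proof -
  obtain V R C K where "parabolic_evolution U V R M' \<omega> C K \<omega>\<^sub>0 \<mu> \<nu>"
    using parabolic_evolution_of_generator[OF H1 evol gen stable] by blast
  then interpret parabolic_evolution U V R M' \<omega> C K \<omega>\<^sub>0 \<mu> \<nu> .
  have \<Gamma>_G: "\<Gamma> = G"
    unfolding Green green_exponentially_stable G_def by (simp add: fun_eq_iff green_exponentially_stable G_def)
  have F_cont: "continuous_on UNIV (\<lambda>(t, x). F t x)"
    using F_QAAP by (simp add: QAAP_param_def)
  have comp_cont: "continuous_on UNIV (\<lambda>s. F s (u s))" if "continuous_on UNIV u" for u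
    using continuous_on_compose2[OF F_cont continuous_on_Pair[OF continuous_on_id that]] by simp
  obtain B0 where B0: "\<And>t. norm (F t 0) \<le> B0"
    using F_0_bounded unfolding bounded_iff by auto
  have F_bound: "norm (F t x) \<le> B0 + L * b" if "norm x \<le> b" for t x b
  proof -
    have "norm (F t x) \<le> norm (F t 0) + norm (F t x - F t 0)"
      using norm_triangle_ineq[of "F t 0" "F t x - F t 0"] by simp
    also have "\<dots> \<le> B0 + L * b"
    proof (rule add_mono[OF B0])
      have "norm (F t x - F t 0) \<le> L * norm x" using Lipschitz[of t x 0] by simp
      also have "\<dots> \<le> L * b" using that L_bounds by (intro mult_left_mono) auto
      finally show "norm (F t x - F t 0) \<le> L * b" .
    qed
    finally show ?thesis .
  qed
  have q: "M' * L / \<omega> \<le> 1 / 2" "0 \<le> M' * L / \<omega>"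
    using L_bounds const_pos by (auto simp: field_simps)
  \<comment> \<open>The fixed point problem is set in the complete space of bounded continuous
    functions; \<open>apply_\<Phi>\<close> checks that the convolution stays in it.\<close>
  define \<Phi> where "\<Phi> u = Bcontfun (conv (\<lambda>s. F s (apply_bcontfun u s)))" for u :: "real \<Rightarrow>\<^sub>C 'a"
  have Fu: "continuous_on UNIV (\<lambda>s. F s (apply_bcontfun u s))"
    "\<And>s. norm (F s (apply_bcontfun u s)) \<le> B0 + L * norm u" for u
    by (auto intro!: comp_cont F_bound norm_bounded)
  have apply_\<Phi>: "apply_bcontfun (\<Phi> u) = conv (\<lambda>s. F s (apply_bcontfun u s))" for u
    unfolding \<Phi>_def
  proof (rule Bcontfun_inverse)
    show "conv (\<lambda>s. F s (apply_bcontfun u s)) \<in> bcontfun"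
      using conv_cont[OF Fu] conv_bound[OF Fu] by (auto simp: bcontfun_def bounded_iff)
  qed
  have "dist (\<Phi> u) (\<Phi> v) \<le> 1 / 2 * dist u v" for u v
  proof (rule dist_bound)
    fix t
    have diff_le: "norm (F s (apply_bcontfun u s) - F s (apply_bcontfun v s)) \<le> L * dist u v" for s
      using dist_bounded[of u s v] L_bounds
      by (intro order_trans[OF Lipschitz] mult_left_mono) (auto simp: dist_norm)
    have "norm (conv (\<lambda>s. F s (apply_bcontfun u s) - F s (apply_bcontfun v s)) t) \<le> M' * (L * dist u v) / \<omega>"
      by (intro conv_bound continuous_intros Fu diff_le)
    also have "\<dots> \<le> 1 / 2 * dist u v"
      using mult_right_mono[OF q(1), of "dist u v"] by (simp add: mult_ac)
    finally show "dist (apply_bcontfun (\<Phi> u) t) (apply_bcontfun (\<Phi> v) t) \<le> 1 / 2 * dist u v"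
      unfolding apply_\<Phi> dist_norm conv_diff[OF Fu Fu] .
  qed
  then have "\<exists>!u. \<Phi> u = u"
    by (intro banach_fix_type[of "1 / 2"]) auto
  then obtain w where w: "\<Phi> w = w" and w_unique: "\<And>v. \<Phi> v = v \<Longrightarrow> v = w" by blast
  \<comment> \<open>Integrals are unique, so being a mild solution is exactly being a fixed point of
    \<Phi>.\<close>
  have mild_iff: "mild_solution \<Gamma> F (apply_bcontfun v) \<longleftrightarrow> \<Phi> v = v" for v
  proof -
    have int: "((\<lambda>s. \<Gamma> t s (F s (apply_bcontfun v s))) has_integral apply_bcontfun (\<Phi> v) t) UNIV" for t
      unfolding apply_\<Phi> \<Gamma>_G by (rule conv_has_integral[OF Fu])
    have "mild_solution \<Gamma> F (apply_bcontfun v) \<longleftrightarrow> (\<forall>t. apply_bcontfun (\<Phi> v) t = apply_bcontfun v t)"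
      unfolding mild_solution_def using int has_integral_unique by (auto dest: has_integral_unique[OF int])
    then show ?thesis by (auto intro: bcontfun_eqI)
  qed
  define u where "u = apply_bcontfun w"
  have fix_u: "u t = conv (\<lambda>s. F s (u s)) t" for t
    using apply_\<Phi>[of w] by (simp add: u_def w)
  define B where "B = B0 + L * norm w"
  \<comment> \<open>The constant of \<open>fixed_point_almost_period\<close>; common
    \<open>\<epsilon> / \<kappa>\<close>-periods of \<open>F\<close> and the kernel are then
    \<epsilon>-periods of \<open>u\<close>.\<close>
  define \<kappa> where "\<kappa> = 2 * (B + M' / \<omega> + 1) + 1"
  have "0 \<le> B"
    unfolding B_def by (rule order_trans[OF norm_ge_zero F_bound[of 0 "norm w"]]) simp
  then have \<kappa>: "0 < \<kappa>" using const_pos by (simp add: \<kappa>_def add_nonneg_pos)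
  define PF where "PF e = {\<tau>. \<exists>T>0. \<forall>t. T \<le> \<bar>t\<bar> \<longrightarrow> (\<forall>x. norm (F (t + \<tau>) x - F t x) \<le> e)}" for e
  \<comment> \<open>The condition \<open>0 \<le> e\<close> makes \<open>ennreal\<close> additive, as
    the closure of periods under differences requires; \<open>ennreal\<close> sends negative reals
    to 0.\<close>
  define PG where "PG e = {\<tau>. 0 \<le> e \<and> (\<exists>T>0. \<forall>t. T \<le> \<bar>t\<bar> \<longrightarrow>
      (\<integral>\<^sup>+ s. ennreal (G_dist (t + \<tau>) t s) \<partial>lborel) \<le> ennreal e)}" for e
  have "\<exists>l>0. \<forall>a. \<exists>\<tau>\<in>{a..a + l}. \<exists>T>0. \<forall>t. T \<le> \<bar>t\<bar> \<longrightarrow> norm (u (t + \<tau>) - u t) \<le> \<epsilon>" if "0 < \<epsilon>" for \<epsilon>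
  proof -
    have "\<exists>l>0. \<forall>a. \<exists>\<tau>\<in>{a..a + l}. \<tau> \<in> PF (\<epsilon> / \<kappa>) \<and> \<tau> \<in> PG (\<epsilon> / \<kappa>)"
    proof (rule common_relatively_dense)
      fix e :: real assume e: "0 < e"
      have F_ex: "\<forall>e>0. \<exists>l>0. \<forall>a. \<exists>\<tau>\<in>{a..a + l}. \<exists>T>0.
          \<forall>B. bounded B \<longrightarrow> (\<forall>t. \<forall>x\<in>B. T \<le> \<bar>t\<bar> \<longrightarrow> norm (F (t + \<tau>) x - F t x) \<le> e)"
        using F_QAAP by (simp add: QAAP_param_def)
      then obtain l where l: "l > 0" "\<forall>a. \<exists>\<tau>\<in>{a..a + l}. \<exists>T>0.
          \<forall>B. bounded B \<longrightarrow> (\<forall>t. \<forall>x\<in>B. T \<le> \<bar>t\<bar> \<longrightarrow> norm (F (t + \<tau>) x - F t x) \<le> e)"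
        using e by blast
      have "\<tau> \<in> PF e" if "\<exists>T>0. \<forall>B. bounded B \<longrightarrow> (\<forall>t. \<forall>x\<in>B. T \<le> \<bar>t\<bar> \<longrightarrow>
          norm (F (t + \<tau>) x - F t x) \<le> e)" for \<tau>
      proof -
        from that obtain T where T: "T > 0 \<and> (\<forall>B. bounded B \<longrightarrow> (\<forall>t. \<forall>x\<in>B. T \<le> \<bar>t\<bar> \<longrightarrow>
            norm (F (t + \<tau>) x - F t x) \<le> e))" by (elim exE)
        \<comment> \<open>The threshold \<open>T\<close> is chosen before the bounded set, so
          testing on singletons gives uniformity over the whole space.\<close>
        have "norm (F (t + \<tau>) x - F t x) \<le> e" if "T \<le> \<bar>t\<bar>" for t x
          using T[THEN conjunct2, rule_format, of "{x}" x t] that by simp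
        then show ?thesis using T unfolding PF_def by blast
      qed
      then show "\<exists>l>0. \<forall>a. \<exists>\<tau>\<in>{a..a + l}. \<tau> \<in> PF e"
        using l by (intro exI[of _ l] conjI allI) (blast)+
      show "\<exists>l>0. \<forall>a. \<exists>\<tau>\<in>{a..a + l}. \<tau> \<in> PG e"
        using Green_QAAP[rule_format, OF e] e by (simp add: PG_def G_dist_def \<Gamma>_G)
      obtain \<delta> where "\<delta> > 0" "\<forall>h. \<bar>h\<bar> < \<delta> \<longrightarrow>
          (\<forall>t. (\<integral>\<^sup>+ s. ennreal (G_dist (t + h) t s) \<partial>lborel) \<le> ennreal e)"
        using nn_integral_G_dist_small[OF e] by blast
      then show "\<exists>\<delta>>0. \<forall>h. \<bar>h\<bar> < \<delta> \<longrightarrow> h \<in> PG e"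
        unfolding PG_def using e zero_less_one less_imp_le by blast
    next
      fix d e x y assume "x \<in> PF d" "y \<in> PF e"
      then obtain T T' where T: "T > 0" "\<And>t z. T \<le> \<bar>t\<bar> \<Longrightarrow> norm (F (t + x) z - F t z) \<le> d"
        and T': "T' > 0" "\<And>t z. T' \<le> \<bar>t\<bar> \<Longrightarrow> norm (F (t + y) z - F t z) \<le> e"
        unfolding PF_def by blast
      have "norm (F (t + (x - y)) z - F t z) \<le> d + e" if t: "max T T' + \<bar>y\<bar> \<le> \<bar>t\<bar>" for t z
      proof -
        have "T \<le> \<bar>t - y\<bar>" "T' \<le> \<bar>t - y\<bar>" using t by auto
        then show ?thesis
        using norm_triangle_ineq4[of "F (t - y + x) z - F (t - y) z" "F (t - y + y) z - F (t - y) z"]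
          T(2)[of "t - y" z] T'(2)[of "t - y" z] by (simp add: algebra_simps)
      qed
      moreover have "0 < max T T' + \<bar>y\<bar>" using T(1) by simp
      ultimately show "x - y \<in> PF (d + e)" unfolding PF_def by blast
    next
      fix d e x y assume "x \<in> PG d" "y \<in> PG e"
      then show "x - y \<in> PG (d + e)"
        unfolding PG_def using nn_integral_G_dist_diff[of x d y e] by simp
    qed (use that \<kappa> in simp)
    moreover have "\<exists>T>0. \<forall>t. T \<le> \<bar>t\<bar> \<longrightarrow> norm (u (t + \<tau>) - u t) \<le> \<epsilon>"
      if "\<tau> \<in> PF (\<epsilon> / \<kappa>)" "\<tau> \<in> PG (\<epsilon> / \<kappa>)" for \<tau>
    proof -
      have "\<exists>T>0. \<forall>t. T \<le> \<bar>t\<bar> \<longrightarrow> norm (u (t + \<tau>) - u t) \<le> (2 * (B + M' / \<omega> + 1) + 1) * (\<epsilon> / \<kappa>)"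
      proof (rule fixed_point_almost_period[where F = F and L = L and B' = "norm w"])
        show "norm (u t) \<le> norm w" for t unfolding u_def by (rule norm_bounded)
        show "continuous_on UNIV (\<lambda>s. F s (u s))" "norm (F s (u s)) \<le> B" for s
          using Fu(1)[of w] Fu(2)[of _ w] by (simp_all add: u_def B_def)
        show "\<exists>T>0. \<forall>t. T \<le> \<bar>t\<bar> \<longrightarrow> (\<forall>x. norm (F (t + \<tau>) x - F t x) \<le> \<epsilon> / \<kappa>)"
          using that(1) by (simp add: PF_def)
        show "\<exists>T>0. \<forall>t. T \<le> \<bar>t\<bar> \<longrightarrow>
            (\<integral>\<^sup>+ s. ennreal (G_dist (t + \<tau>) t s) \<partial>lborel) \<le> ennreal (\<epsilon> / \<kappa>)"
          using that(2) by (simp add: PG_def)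
        show "0 < \<epsilon> / \<kappa>" using \<open>0 < \<epsilon>\<close> \<kappa> by simp
        show "0 \<le> L" using L_bounds by simp
      qed (rule fix_u q Lipschitz)+
      moreover have "\<kappa> * (\<epsilon> / \<kappa>) = \<epsilon>" using \<kappa> by simp
      ultimately show ?thesis by (simp only: \<kappa>_def[symmetric])
    qed
    ultimately show ?thesis by meson
  qed
  then have "u \<in> QAAP" by (simp add: QAAP_def u_def)
  moreover have "mild_solution \<Gamma> F u" unfolding u_def mild_iff by (rule w)
  \<comment> \<open>Uniqueness holds among all mild solutions: each is bounded and continuous, hence
    a fixed point of \<Phi>.\<close>
  moreover have "v = u" if "mild_solution \<Gamma> F v" for v
  proof -
    have "v \<in> bcontfun" using that by (simp add: mild_solution_def bcontfun_def)
    then obtain v' where "v = apply_bcontfun v'" by (rule bcontfunE)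
    then show ?thesis using that w_unique[of v'] mild_iff[of v'] by (simp add: u_def)
  qed
  ultimately show ?thesis by blast
qed

end
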